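(* Let $M,N$ be nondegenerate Orlicz functions with upper Matuszewska-Orlicz indices $\beta_M,\beta_N\in[1,\infty]$. If $\beta_M>2$ and $\beta_N<\beta_M$, then the Orlicz sequence space $h_M$ does not coarsely embed into the Orlicz sequence space $h_N$, and $h_M$ does not uniformly embed into $h_N$.
   Context: All Banach spaces are real. Orlicz functions and spaces. A function $M:[0,\infty)\to[0,\infty)$ is an Orlicz function if it is continuous, nondecreasing and convex, $M(0)=0$ and $\lim_{t\to\infty}M(t)=\infty$. It is nondegenerate if $M(t)>0$ for all $t>0$. $\ell_M$ is the Banach space of real sequences $x=(x_n)_{n=1}^\infty$ with $\sum_n M(|x_n|/\rho)<\infty$ for some $\rho>0$, with norm $\|x\|=\inf\{\rho>0:\sum_{n=1}^\infty M(|x_n|/\rho)\leq1\}$. $h_M$ is the closed subspace of $\ell_M$ of those $x$ with $\sum_n M(|x_n|/\rho)<\infty$ for every $\rho>0$, with the inherited norm. Upper Matuszewska-Orlicz index: $\beta_M=\inf\left\{q\in\mathbb{R}:\inf_{\lambda,t\in(0,1]}\frac{M(\lambda t)}{M(\lambda)t^q}>0\right\}$, with $\inf\emptyset=\infty$; one has $1\le\beta_M\le\infty$. Embeddings. Let $f:X\to Y$ be a map between metric spaces $(X,d_X),(Y,d_Y)$. $f$ is a coarse embedding if there are nondecreasing $\rho_1,\rho_2:[0,\infty)\to[0,\infty)$ with $\lim_{t\to\infty}\rho_1(t)=\infty$ and $\rho_1(d_X(x,y))\leq d_Y(f(x),f(y))\leq\rho_2(d_X(x,y))$ for all $x,y\in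 X$. $f$ is a uniform embedding if it is injective and both $f$ and $f^{-1}:f(X)\to X$ are uniformly continuous. $X$ coarsely (respectively uniformly) embeds into $Y$ if there exists a coarse (respectively uniform) embedding $X\to Y$. *)

theory Defs
  imports "HOL-Analysis.Analysis"
begin

section \<open>Orlicz functions\<close>

text \<open>
  An Orlicz function is represented by a function on all of \<open>\<real>\<close> of which only the restriction to
  \<open>[0,\<infinity>)\<close> matters: every definition below evaluates it at nonnegative arguments only.
\<close>

definition orlicz_function :: "(real \<Rightarrow> real) \<Rightarrow> bool" where
  "orlicz_function M \<longleftrightarrow>
     M \<in> {0..} \<rightarrow> {0..} \<and> continuous_on {0..} M \<and> mono_on {0..} M \<and> convex_on {0..} M \<and>
     M 0 = 0 \<and> filterlim M at_top at_top"

definition nondegenerate :: "(real \<Rightarrow> real) \<Rightarrow> bool" where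
  "nondegenerate M \<longleftrightarrow> (\<forall>t>0. M t > 0)"

text \<open>
  The outer infimum is taken in the extended reals, so it is \<open>\<infinity>\<close> for the empty set. The inner
  real infimum is over a nonempty set of nonnegative numbers; for nondegenerate \<open>M\<close> no division by
  zero occurs.
\<close>

definition upper_MO_index :: "(real \<Rightarrow> real) \<Rightarrow> ereal" where
  "upper_MO_index M =
     Inf (ereal ` {q. (INF (l, t) \<in> {0<..1} \<times> {0<..1}. M (l * t) / (M l * t powr q)) > 0})"


section \<open>Orlicz sequence spaces\<close>

text \<open>All terms below are nonnegative, so finiteness of a series is its summability.\<close>

definition ell_space :: "(real \<Rightarrow> real) \<Rightarrow> (nat \<Rightarrow> real) set" where
  "ell_space M = {x. \<exists>\<rho>>0. summable (\<lambda>n. M (\<bar>x n\<bar> / \<rho>))}"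

definition h_space :: "(real \<Rightarrow> real) \<Rightarrow> (nat \<Rightarrow> real) set" where
  "h_space M = {x \<in> ell_space M. \<forall>\<rho>>0. summable (\<lambda>n. M (\<bar>x n\<bar> / \<rho>))}"

definition orlicz_norm_set :: "(real \<Rightarrow> real) \<Rightarrow> (nat \<Rightarrow> real) \<Rightarrow> real set" where
  "orlicz_norm_set M x =
     {\<rho>. \<rho> > 0 \<and> summable (\<lambda>n. M (\<bar>x n\<bar> / \<rho>)) \<and> (\<Sum>n. M (\<bar>x n\<bar> / \<rho>)) \<le> 1}"

text \<open>
  The value outside \<open>ell_space M\<close> is a dummy; it is needed because the library's metric spaces
  require the distance function to be nonnegative on the whole type.
\<close>

definition orlicz_norm :: "(real \<Rightarrow> real) \<Rightarrow> (nat \<Rightarrow> real) \<Rightarrow> real" where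
  "orlicz_norm M x = (if x \<in> ell_space M then Inf (orlicz_norm_set M x) else 0)"

definition orlicz_dist :: "(real \<Rightarrow> real) \<Rightarrow> (nat \<Rightarrow> real) \<Rightarrow> (nat \<Rightarrow> real) \<Rightarrow> real" where
  "orlicz_dist M x y = orlicz_norm M (\<lambda>n. x n - y n)"

definition ell_metric :: "(real \<Rightarrow> real) \<Rightarrow> (nat \<Rightarrow> real) metric" where
  "ell_metric M = metric (ell_space M, orlicz_dist M)"

definition h_metric :: "(real \<Rightarrow> real) \<Rightarrow> (nat \<Rightarrow> real) metric" where
  "h_metric M = submetric (ell_metric M) (h_space M)"


section \<open>Coarse and uniform embeddings\<close>

definition coarse_embedding :: "'a metric \<Rightarrow> 'b metric \<Rightarrow> ('a \<Rightarrow> 'b) \<Rightarrow> bool" where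
  "coarse_embedding X Y f \<longleftrightarrow>
     f \<in> mspace X \<rightarrow> mspace Y \<and>
     (\<exists>\<rho>\<^sub>1 \<rho>\<^sub>2 :: real \<Rightarrow> real.
        \<rho>\<^sub>1 \<in> {0..} \<rightarrow> {0..} \<and> \<rho>\<^sub>2 \<in> {0..} \<rightarrow> {0..} \<and>
        mono_on {0..} \<rho>\<^sub>1 \<and> mono_on {0..} \<rho>\<^sub>2 \<and> filterlim \<rho>\<^sub>1 at_top at_top \<and>
        (\<forall>x\<in>mspace X. \<forall>y\<in>mspace X.
           \<rho>\<^sub>1 (mdist X x y) \<le> mdist Y (f x) (f y) \<and> mdist Y (f x) (f y) \<le> \<rho>\<^sub>2 (mdist X x y)))"

definition uniform_embedding :: "'a metric \<Rightarrow> 'b metric \<Rightarrow> ('a \<Rightarrow> 'b) \<Rightarrow> bool" where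
  "uniform_embedding X Y f \<longleftrightarrow>
     inj_on f (mspace X) \<and> uniformly_continuous_map X Y f \<and>
     uniformly_continuous_map (submetric Y (f ` mspace X)) X (inv_into (mspace X) f)"

definition coarsely_embeds :: "'a metric \<Rightarrow> 'b metric \<Rightarrow> bool" where
  "coarsely_embeds X Y \<longleftrightarrow> (\<exists>f. coarse_embedding X Y f)"

definition uniformly_embeds :: "'a metric \<Rightarrow> 'b metric \<Rightarrow> bool" where
  "uniformly_embeds X Y \<longleftrightarrow> (\<exists>f. uniform_embedding X Y f)"


section \<open>The Orlicz norm induces a metric\<close>

text \<open>
  The constructor of the type of metric spaces is meaningful only on actual metrics; the following
  facts show that \<open>ell_metric M\<close> and \<open>h_metric M\<close> are the intended spaces.
\<close>

context
  fixes M :: "real \<Rightarrow> real"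
  assumes M: "orlicz_function M"
begin

lemma orlicz_nonneg: "t \<ge> 0 \<Longrightarrow> M t \<ge> 0"
  using M by (auto simp: orlicz_function_def)

lemma orlicz_mono: "0 \<le> s \<Longrightarrow> s \<le> t \<Longrightarrow> M s \<le> M t"
  using M by (auto simp: orlicz_function_def mono_on_def)

lemma orlicz_zero: "M 0 = 0"
  using M by (auto simp: orlicz_function_def)

lemma orlicz_convex:
  assumes "s \<ge> 0" "t \<ge> 0" "u \<ge> 0" "v \<ge> 0" "u + v = 1"
  shows "M (u * s + v * t) \<le> u * M s + v * M t"
  using M assms by (auto simp: orlicz_function_def convex_on_def)

lemma orlicz_norm_set_mono:
  assumes "a \<in> orlicz_norm_set M x" "a \<le> b"
  shows "b \<in> orlicz_norm_set M x"
proof -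
  have a: "a > 0" "summable (\<lambda>n. M (\<bar>x n\<bar> / a))" "(\<Sum>n. M (\<bar>x n\<bar> / a)) \<le> 1"
    using assms by (auto simp: orlicz_norm_set_def)
  have le: "M (\<bar>x n\<bar> / b) \<le> M (\<bar>x n\<bar> / a)" for n
    using a(1) assms(2) by (intro orlicz_mono divide_left_mono) auto
  have nn: "0 \<le> M (\<bar>x n\<bar> / b)" for n
    using a(1) assms(2) by (intro orlicz_nonneg) auto
  have s: "summable (\<lambda>n. M (\<bar>x n\<bar> / b))"
    by (rule summable_comparison_test'[OF a(2), of 0]) (use le nn in auto)
  have "(\<Sum>n. M (\<bar>x n\<bar> / b)) \<le> (\<Sum>n. M (\<bar>x n\<bar> / a))"
    by (rule suminf_le[OF le s a(2)])
  then show ?thesis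
    using a s assms(2) by (auto simp: orlicz_norm_set_def)
qed

lemma orlicz_norm_set_nonempty:
  assumes "x \<in> ell_space M"
  shows "orlicz_norm_set M x \<noteq> {}"
proof -
  obtain \<rho> where r: "\<rho> > 0" "summable (\<lambda>n. M (\<bar>x n\<bar> / \<rho>))"
    using assms by (auto simp: ell_space_def)
  define c where "c = max 1 (\<Sum>n. M (\<bar>x n\<bar> / \<rho>))"
  have c: "c \<ge> 1" "(\<Sum>n. M (\<bar>x n\<bar> / \<rho>)) \<le> c"
    by (auto simp: c_def)
  have le: "M (\<bar>x n\<bar> / (c * \<rho>)) \<le> M (\<bar>x n\<bar> / \<rho>) / c" for n
    using orlicz_convex[of "\<bar>x n\<bar> / \<rho>" 0 "1 / c" "1 - 1 / c"] r(1) c(1)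
    by (simp add: orlicz_zero)
  have nn: "0 \<le> M (\<bar>x n\<bar> / (c * \<rho>))" for n
    using r(1) c(1) by (intro orlicz_nonneg) auto
  have s': "summable (\<lambda>n. M (\<bar>x n\<bar> / \<rho>) / c)"
    using r(2) by (rule summable_divide)
  have s: "summable (\<lambda>n. M (\<bar>x n\<bar> / (c * \<rho>)))"
    by (rule summable_comparison_test'[OF s', of 0]) (use le nn in auto)
  have "(\<Sum>n. M (\<bar>x n\<bar> / (c * \<rho>))) \<le> (\<Sum>n. M (\<bar>x n\<bar> / \<rho>) / c)"
    by (rule suminf_le[OF le s s'])
  also have "\<dots> = (\<Sum>n. M (\<bar>x n\<bar> / \<rho>)) / c"
    by (rule suminf_divide[OF r(2)])
  also have "\<dots> \<le> 1"
    using c by simp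
  finally have "c * \<rho> \<in> orlicz_norm_set M x"
    using s r c by (auto simp: orlicz_norm_set_def)
  then show ?thesis by blast
qed

lemma orlicz_norm_set_add:
  assumes "a \<in> orlicz_norm_set M x" "b \<in> orlicz_norm_set M y"
  shows "a + b \<in> orlicz_norm_set M (\<lambda>n. x n + y n)"
proof -
  have a: "a > 0" "summable (\<lambda>n. M (\<bar>x n\<bar> / a))" "(\<Sum>n. M (\<bar>x n\<bar> / a)) \<le> 1"
    and b: "b > 0" "summable (\<lambda>n. M (\<bar>y n\<bar> / b))" "(\<Sum>n. M (\<bar>y n\<bar> / b)) \<le> 1"
    using assms by (auto simp: orlicz_norm_set_def)
  define u v where "u = a / (a + b)" and "v = b / (a + b)"
  have uv: "u \<ge> 0" "v \<ge> 0" "u + v = 1"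
    using a(1) b(1) by (auto simp: u_def v_def add_divide_distrib[symmetric])
  let ?g = "\<lambda>n. u * M (\<bar>x n\<bar> / a) + v * M (\<bar>y n\<bar> / b)"
  have le: "M (\<bar>x n + y n\<bar> / (a + b)) \<le> ?g n" for n
  proof -
    have "\<bar>x n + y n\<bar> / (a + b) \<le> (\<bar>x n\<bar> + \<bar>y n\<bar>) / (a + b)"
      using a(1) b(1) by (intro divide_right_mono) auto
    also have "\<dots> = u * (\<bar>x n\<bar> / a) + v * (\<bar>y n\<bar> / b)"
      using a(1) b(1) by (simp add: u_def v_def add_divide_distrib)
    finally have "M (\<bar>x n + y n\<bar> / (a + b)) \<le> M (u * (\<bar>x n\<bar> / a) + v * (\<bar>y n\<bar> / b))"
      using a(1) b(1) by (intro orlicz_mono) auto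
    also have "\<dots> \<le> ?g n"
      using a(1) b(1) uv by (intro orlicz_convex) auto
    finally show ?thesis .
  qed
  have nn: "0 \<le> M (\<bar>x n + y n\<bar> / (a + b))" for n
    using a(1) b(1) by (intro orlicz_nonneg) auto
  have s': "summable ?g"
    by (intro summable_add summable_mult a b)
  have s: "summable (\<lambda>n. M (\<bar>x n + y n\<bar> / (a + b)))"
    by (rule summable_comparison_test'[OF s', of 0]) (use le nn in auto)
  have "(\<Sum>n. M (\<bar>x n + y n\<bar> / (a + b))) \<le> suminf ?g"
    by (rule suminf_le[OF le s s'])
  also have "\<dots> = u * (\<Sum>n. M (\<bar>x n\<bar> / a)) + v * (\<Sum>n. M (\<bar>y n\<bar> / b))"
    using a(2) b(2) by (simp add: suminf_add[symmetric] suminf_mult summable_mult)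
  also have "\<dots> \<le> u * 1 + v * 1"
    using a b uv by (intro add_mono mult_left_mono) auto
  finally show ?thesis
    using uv s a(1) b(1) by (auto simp: orlicz_norm_set_def)
qed

lemma orlicz_norm_set_bdd: "bdd_below (orlicz_norm_set M x)"
  by (rule bdd_belowI[of _ 0]) (auto simp: orlicz_norm_set_def)

lemma orlicz_norm_nonneg: "orlicz_norm M x \<ge> 0"
proof (cases "x \<in> ell_space M")
  case True
  have "0 \<le> Inf (orlicz_norm_set M x)"
    by (rule cInf_greatest[OF orlicz_norm_set_nonempty[OF True]]) (auto simp: orlicz_norm_set_def)
  then show ?thesis
    by (simp add: orlicz_norm_def)
qed (simp add: orlicz_norm_def)

lemma orlicz_norm_eq_0_iff:
  assumes "x \<in> ell_space M"
  shows "orlicz_norm M x = 0 \<longleftrightarrow> (\<forall>n. x n = 0)"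
proof
  assume "\<forall>n. x n = 0"
  then have "orlicz_norm_set M x = {0<..}"
    by (auto simp: orlicz_norm_set_def orlicz_zero)
  then show "orlicz_norm M x = 0"
    using assms by (simp add: orlicz_norm_def)
next
  assume 0: "orlicz_norm M x = 0"
  show "\<forall>n. x n = 0"
  proof (rule ccontr)
    assume "\<not> (\<forall>n. x n = 0)"
    then obtain k where k: "x k \<noteq> 0" by blast
    have "eventually (\<lambda>t. M t > 1) at_top"
      using M unfolding orlicz_function_def filterlim_at_top_dense by blast
    then have "eventually (\<lambda>t. M t > 1 \<and> t > 0) at_top"
      using eventually_gt_at_top[of 0] by (rule eventually_conj)
    then obtain T where T: "M T > 1" "T > 0"
      by (auto dest: eventually_happens)
    have "Inf (orlicz_norm_set M x) < \<bar>x k\<bar> / T"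
      using 0 k T(2) assms by (simp add: orlicz_norm_def)
    then obtain \<rho> where r: "\<rho> \<in> orlicz_norm_set M x" "\<rho> < \<bar>x k\<bar> / T"
      using cInf_lessD[OF orlicz_norm_set_nonempty[OF assms]] by blast
    then have r': "\<rho> > 0" "summable (\<lambda>n. M (\<bar>x n\<bar> / \<rho>))" "(\<Sum>n. M (\<bar>x n\<bar> / \<rho>)) \<le> 1"
      by (auto simp: orlicz_norm_set_def)
    have "T \<le> \<bar>x k\<bar> / \<rho>"
      using r(2) r'(1) T(2) by (simp add: field_simps)
    then have "1 < M (\<bar>x k\<bar> / \<rho>)"
      using orlicz_mono[of T "\<bar>x k\<bar> / \<rho>"] T by auto
    also have "\<dots> = (\<Sum>n\<in>{k}. M (\<bar>x n\<bar> / \<rho>))"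
      by simp
    also have "\<dots> \<le> (\<Sum>n. M (\<bar>x n\<bar> / \<rho>))"
      using r' by (intro sum_le_suminf) (auto intro: orlicz_nonneg)
    finally show False
      using r'(3) by simp
  qed
qed

lemma ell_space_add:
  assumes "x \<in> ell_space M" "y \<in> ell_space M"
  shows "(\<lambda>n. x n + y n) \<in> ell_space M"
proof -
  obtain a b where "a \<in> orlicz_norm_set M x" "b \<in> orlicz_norm_set M y"
    using orlicz_norm_set_nonempty assms by blast
  from orlicz_norm_set_add[OF this] show ?thesis
    by (auto simp: orlicz_norm_set_def ell_space_def)
qed

lemma ell_space_diff:
  assumes "x \<in> ell_space M" "y \<in> ell_space M"
  shows "(\<lambda>n. x n - y n) \<in> ell_space M"
  using ell_space_add[of x "\<lambda>n. - y n"] assms by (simp add: ell_space_def)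

lemma orlicz_norm_triangle:
  assumes "x \<in> ell_space M" "y \<in> ell_space M"
  shows "orlicz_norm M (\<lambda>n. x n + y n) \<le> orlicz_norm M x + orlicz_norm M y"
proof -
  let ?s = "Inf (orlicz_norm_set M (\<lambda>n. x n + y n))"
  have *: "?s - b \<le> Inf (orlicz_norm_set M x)" if b: "b \<in> orlicz_norm_set M y" for b
  proof (rule cInf_greatest[OF orlicz_norm_set_nonempty[OF assms(1)]])
    fix a assume "a \<in> orlicz_norm_set M x"
    then show "?s - b \<le> a"
      using cInf_lower[OF orlicz_norm_set_add[OF _ b] orlicz_norm_set_bdd]
      by (simp add: diff_le_eq)
  qed
  have "?s - Inf (orlicz_norm_set M x) \<le> Inf (orlicz_norm_set M y)"
    by (rule cInf_greatest[OF orlicz_norm_set_nonempty[OF assms(2)]]) (use * in force)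
  then show ?thesis
    using assms ell_space_add[OF assms] by (simp add: orlicz_norm_def)
qed

lemma orlicz_Metric_space: "Metric_space (ell_space M) (orlicz_dist M)"
proof
  fix x y z
  show "0 \<le> orlicz_dist M x y" by (simp add: orlicz_dist_def orlicz_norm_nonneg)
  show "orlicz_dist M x y = orlicz_dist M y x"
    unfolding orlicz_dist_def orlicz_norm_def orlicz_norm_set_def ell_space_def mem_Collect_eq
    by (simp only: abs_minus_commute[of "x _" "y _"])
  assume x: "x \<in> ell_space M" and y: "y \<in> ell_space M"
  show "orlicz_dist M x y = 0 \<longleftrightarrow> x = y"
    using orlicz_norm_eq_0_iff[OF ell_space_diff[OF x y]] by (auto simp: orlicz_dist_def)
  assume z: "z \<in> ell_space M"
  show "orlicz_dist M x z \<le> orlicz_dist M x y + orlicz_dist M y z"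
    using orlicz_norm_triangle[OF ell_space_diff[OF x y] ell_space_diff[OF y z]]
    by (simp add: orlicz_dist_def)
qed

lemma mspace_ell_metric: "mspace (ell_metric M) = ell_space M"
  and mdist_ell_metric: "mdist (ell_metric M) = orlicz_dist M"
  by (simp_all add: ell_metric_def Metric_space.mspace_metric[OF orlicz_Metric_space]
      Metric_space.mdist_metric[OF orlicz_Metric_space])

lemma mspace_h_metric: "mspace (h_metric M) = h_space M"
  and mdist_h_metric: "mdist (h_metric M) = orlicz_dist M"
  by (auto simp: h_metric_def mspace_ell_metric mdist_ell_metric h_space_def)

end

end

(*
  Coordinatewise trigonometric functions at dyadic scales turn the modular of N into a q-th power
  of a distance in l_q (beta_N < q < beta_M, q >= 2), so for maps F of the grid Z^n into h_N one may
  argue as if the target were l_q. For scalar functions and q >= 2 a cotype inequality is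
  elementary: averaging F(x + e) over all signs e_i with i different from j gives functions E_j F
  whose increments in direction j are the Rademacher coefficients of e |-> F(x + e) - F(x), and
  Bessel's inequality bounds the sum over j of their q-th powers by the steps of F. Averaging over a
  box of side L with L^q <= n yields a direction j and a point x for which F(x + 2L e_j) - F(x) is
  bounded by a constant times the largest step of F. On the other hand, since q < beta_M, suitable
  multiples of n disjoint blocks in h_M span a copy of the grid whose neighbours are at distance at
  most a, while x and x + 2L e_j are at distance at least b, with b/a as large as we please. This
  contradicts both coarse and uniform embeddability.
*)

theory Submission
  imports Defs
begin

section \<open>Means and powers\<close>

text \<open>If an argument is 0, convexity reduces to
  \<open>(u * z) powr p \<le> u * z powr p\<close> for \<open>0 < u < 1\<close>, which holds because
  \<open>u powr p \<le> u\<close>; positive arguments are covered by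
  \<open>powr_convex\<close>.\<close>

lemma convex_on_powr_nonneg:
  assumes "p \<ge> 1"
  shows "convex_on {0::real..} (\<lambda>x. x powr p)"
proof (rule convex_onI)
  fix t x y :: real
  assume t: "0 < t" "t < 1" and xy: "x \<in> {0..}" "y \<in> {0..}"
  have le: "(u * z) powr p \<le> u * z powr p" if "0 < u" "u < 1" "0 \<le> z" for u z :: real
  proof -
    have "u powr p \<le> u powr 1"
      using that assms by (intro powr_mono') auto
    then show ?thesis
      using that by (simp add: powr_mult mult_right_mono)
  qed
  show "((1 - t) *\<^sub>R x + t *\<^sub>R y) powr p \<le> (1 - t) * x powr p + t * y powr p"
  proof (cases "x = 0 \<or> y = 0")
    case True
    then show ?thesis
      using le[of t y] le[of "1 - t" x] t xy by auto
  next
    case False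
    then show ?thesis
      using convex_onD[OF powr_convex[OF assms], of t x y] t xy by auto
  qed
qed auto

lemma powr_mean_le_mean_powr:
  fixes u :: "'a \<Rightarrow> real"
  assumes "finite S" "p \<ge> 1" "\<And>e. e \<in> S \<Longrightarrow> u e \<ge> 0"
  shows "((\<Sum>e\<in>S. u e) / card S) powr p \<le> (\<Sum>e\<in>S. u e powr p) / card S"
proof (cases "S = {}")
  case False
  then show ?thesis
    using convex_on_sum[OF assms(1) False convex_on_powr_nonneg[OF assms(2)],
        of "\<lambda>_. 1 / card S" u] assms
    by (simp add: sum_divide_distrib)
qed auto

lemma norm_mean_powr_le:
  fixes u :: "'a \<Rightarrow> 'b::real_normed_vector"
  assumes "finite S" "p \<ge> 1"
  shows "norm ((1 / card S) *\<^sub>R (\<Sum>e\<in>S. u e)) powr p \<le> (\<Sum>e\<in>S. norm (u e) powr p) / card S"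
proof -
  have "norm ((1 / card S) *\<^sub>R (\<Sum>e\<in>S. u e)) \<le> (\<Sum>e\<in>S. norm (u e)) / card S"
    by (simp add: divide_right_mono norm_sum)
  then have "norm ((1 / card S) *\<^sub>R (\<Sum>e\<in>S. u e)) powr p \<le> ((\<Sum>e\<in>S. norm (u e)) / card S) powr p"
    using assms(2) by (intro powr_mono2) auto
  also have "\<dots> \<le> (\<Sum>e\<in>S. norm (u e) powr p) / card S"
    using assms by (intro powr_mean_le_mean_powr) auto
  finally show ?thesis .
qed

text \<open>The l_q norm is at most the l_2 norm: one splits off \<open>(a j)\<^sup>2\<close> from
  the q-th power and bounds the remaining factor by a power of the whole sum of squares.\<close>

lemma sum_powr_le_powr_sum_squares:
  fixes a :: "'a \<Rightarrow> real"
  assumes "finite J" "q \<ge> 2" "\<And>j. j \<in> J \<Longrightarrow> a j \<ge> 0"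
  shows "(\<Sum>j\<in>J. a j powr q) \<le> (\<Sum>j\<in>J. (a j)\<^sup>2) powr (q / 2)"
proof -
  define s where "s = (\<Sum>j\<in>J. (a j)\<^sup>2)"
  have s: "s \<ge> 0"
    by (auto simp: s_def intro: sum_nonneg)
  have "a j powr q \<le> (a j)\<^sup>2 * s powr (q / 2 - 1)" if j: "j \<in> J" for j
  proof -
    have "(a j)\<^sup>2 \<le> s"
      unfolding s_def using assms j by (intro member_le_sum) auto
    then have "((a j)\<^sup>2) powr (q / 2 - 1) \<le> s powr (q / 2 - 1)"
      using assms by (intro powr_mono2) auto
    moreover have "a j powr q = (a j)\<^sup>2 * ((a j)\<^sup>2) powr (q / 2 - 1)"
    proof (cases "a j = 0")
      case False
      then have "a j > 0" using assms(3)[OF j] by simp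
      then show ?thesis
        by (simp add: powr_powr powr_numeral[symmetric] powr_add[symmetric] algebra_simps
            del: powr_numeral)
    qed auto
    ultimately show ?thesis
      by (simp add: mult_left_mono)
  qed
  then have "(\<Sum>j\<in>J. a j powr q) \<le> (\<Sum>j\<in>J. (a j)\<^sup>2 * s powr (q / 2 - 1))"
    by (rule sum_mono)
  also have "\<dots> = s * s powr (q / 2 - 1)"
    by (simp add: s_def sum_distrib_right)
  also have "\<dots> = s powr (q / 2)"
    using s by (cases "s = 0") (auto simp: powr_mult_base)
  finally show ?thesis
    by (simp add: s_def)
qed

lemma powr_norm_add3_le:
  fixes a b c :: "'b::real_normed_vector"
  assumes "q \<ge> 0"
  shows "norm (a + b + c) powr q \<le> 3 powr q * (norm a powr q + norm b powr q + norm c powr q)"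
proof -
  define m where "m = max (norm a) (max (norm b) (norm c))"
  have "norm (a + b + c) \<le> norm a + norm b + norm c"
    by (meson add_right_mono norm_triangle_ineq order_trans)
  also have "\<dots> \<le> 3 * m"
    by (auto simp: m_def)
  finally have "norm (a + b + c) powr q \<le> (3 * m) powr q"
    using assms by (intro powr_mono2) auto
  also have "\<dots> = 3 powr q * m powr q"
    by (simp add: powr_mult m_def)
  also have "m powr q \<le> norm a powr q + norm b powr q + norm c powr q"
    by (auto simp: m_def max_def)
  finally show ?thesis
    by (simp add: mult_left_mono)
qed

section \<open>Rademacher coefficients on the discrete cube\<close>

text \<open>The default value 0 outside \<open>{..<n}\<close> makes the set finite, and adding a
  sign vector to a grid point leaves the coordinates beyond \<open>n\<close> alone.\<close>

definition sign_vectors :: "nat \<Rightarrow> (nat \<Rightarrow> int) set" where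
  "sign_vectors n = {e. \<forall>i. (i \<in> {..<n} \<longrightarrow> e i \<in> {-1, 1}) \<and> (i \<notin> {..<n} \<longrightarrow> e i = 0)}"

lemma finite_sign_vectors: "finite (sign_vectors n)"
  unfolding sign_vectors_def by (rule finite_set_of_finite_funs) auto

lemma card_sign_vectors_pos: "card (sign_vectors n) > 0"
proof -
  have "(\<lambda>i. if i < n then 1 else 0) \<in> sign_vectors n"
    by (auto simp: sign_vectors_def)
  then show ?thesis
    using finite_sign_vectors card_gt_0_iff by blast
qed

lemma sum_sign_vectors_flip:
  fixes h :: "(nat \<Rightarrow> int) \<Rightarrow> 'b::comm_monoid_add"
  assumes "j < n"
  shows "(\<Sum>e\<in>sign_vectors n. h (e(j := - e j))) = (\<Sum>e\<in>sign_vectors n. h e)"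
  by (rule sum.reindex_bij_witness[where i = "\<lambda>e. e(j := - e j)" and j = "\<lambda>e. e(j := - e j)"])
     (use assms in \<open>auto simp: sign_vectors_def\<close>)

lemma sign_vectors_square: "e \<in> sign_vectors n \<Longrightarrow> j < n \<Longrightarrow> e j * e j = 1"
  by (auto simp: sign_vectors_def)

lemma sign_vectors_abs: "e \<in> sign_vectors n \<Longrightarrow> \<bar>e i\<bar> = (if i < n then 1 else 0)"
  by (auto simp: sign_vectors_def)

text \<open>For \<open>i \<noteq> j\<close>, flipping the sign of coordinate \<open>i\<close> turns
  the sum into its negative.\<close>

lemma sign_vectors_orthogonal:
  assumes "i < n" "j < n"
  shows "(\<Sum>e\<in>sign_vectors n. real_of_int (e i * e j)) = (if i = j then card (sign_vectors n) else 0)"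
proof (cases "i = j")
  case True
  have "(\<Sum>e\<in>sign_vectors n. real_of_int (e i * e j)) = (\<Sum>e\<in>sign_vectors n. 1)"
    by (rule sum.cong) (use True assms in \<open>auto simp del: of_int_mult simp: sign_vectors_square\<close>)
  then show ?thesis using True by simp
next
  case False
  have "(\<Sum>e\<in>sign_vectors n. real_of_int (e i * e j)) = (\<Sum>e\<in>sign_vectors n. - real_of_int (e i * e j))"
    by (subst sum_sign_vectors_flip[OF assms(1), symmetric]) (use False in simp)
  then show ?thesis using False by (simp add: sum_negf)
qed

definition rademacher_coeff :: "nat \<Rightarrow> ((nat \<Rightarrow> int) \<Rightarrow> 'b::real_vector) \<Rightarrow> nat \<Rightarrow> 'b" where
  "rademacher_coeff n g j =
     (1 / card (sign_vectors n)) *\<^sub>R (\<Sum>e\<in>sign_vectors n. real_of_int (e j) *\<^sub>R g e)"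

text \<open>The squared distances between \<open>g\<close> and its Rademacher projection have a
  nonnegative sum over the cube. By orthogonality the cross term and the square of the projection
  both equal \<open>m\<close> times the sum of the squared coefficients.\<close>

lemma rademacher_bessel:
  fixes g :: "(nat \<Rightarrow> int) \<Rightarrow> 'b::real_inner"
  shows "(\<Sum>j<n. (norm (rademacher_coeff n g j))\<^sup>2) \<le>
    (\<Sum>e\<in>sign_vectors n. (norm (g e))\<^sup>2) / card (sign_vectors n)"
proof -
  define S where "S = sign_vectors n"
  define m where "m = real (card S)"
  define a where "a = rademacher_coeff n g"
  have m: "m > 0"
    using card_sign_vectors_pos by (simp add: m_def S_def)
  have ma: "(\<Sum>e\<in>S. real_of_int (e j) *\<^sub>R g e) = m *\<^sub>R a j" for j
    using m by (simp add: a_def rademacher_coeff_def m_def S_def)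
  have cross: "(\<Sum>e\<in>S. g e \<bullet> (\<Sum>j<n. real_of_int (e j) *\<^sub>R a j)) = m * (\<Sum>j<n. (norm (a j))\<^sup>2)"
  proof -
    have "(\<Sum>e\<in>S. g e \<bullet> (\<Sum>j<n. real_of_int (e j) *\<^sub>R a j)) =
        (\<Sum>j<n. (\<Sum>e\<in>S. real_of_int (e j) *\<^sub>R g e) \<bullet> a j)"
      by (simp add: inner_sum_right inner_sum_left sum.swap[of _ S])
    then show ?thesis
      by (simp add: ma power2_norm_eq_inner sum_distrib_left)
  qed
  have sq: "(\<Sum>e\<in>S. (norm (\<Sum>j<n. real_of_int (e j) *\<^sub>R a j))\<^sup>2) = m * (\<Sum>j<n. (norm (a j))\<^sup>2)"
  proof -
    have "(\<Sum>e\<in>S. (norm (\<Sum>j<n. real_of_int (e j) *\<^sub>R a j))\<^sup>2) =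
        (\<Sum>e\<in>S. \<Sum>i<n. \<Sum>j<n. real_of_int (e i * e j) * (a i \<bullet> a j))"
      by (simp only: power2_norm_eq_inner inner_sum_left)
         (simp add: inner_sum_right mult.assoc mult.left_commute sum_distrib_left)
    also have "\<dots> = (\<Sum>i<n. \<Sum>j<n. (\<Sum>e\<in>S. real_of_int (e i * e j)) * (a i \<bullet> a j))"
      by (subst sum.swap, rule sum.cong[OF refl], subst sum.swap) (simp add: sum_distrib_right)
    also have "\<dots> = (\<Sum>i<n. \<Sum>j<n. if i = j then m * (a i \<bullet> a j) else 0)"
      by (intro sum.cong refl) (use sign_vectors_orthogonal in \<open>auto simp: S_def m_def\<close>)
    also have "\<dots> = m * (\<Sum>j<n. (norm (a j))\<^sup>2)"
      by (simp add: power2_norm_eq_inner sum_distrib_left)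
    finally show ?thesis .
  qed
  have "0 \<le> (\<Sum>e\<in>S. (norm (g e - (\<Sum>j<n. real_of_int (e j) *\<^sub>R a j)))\<^sup>2)"
    by (intro sum_nonneg) auto
  also have "\<dots> = (\<Sum>e\<in>S. (norm (g e))\<^sup>2) - 2 * (\<Sum>e\<in>S. g e \<bullet> (\<Sum>j<n. real_of_int (e j) *\<^sub>R a j))
      + (\<Sum>e\<in>S. (norm (\<Sum>j<n. real_of_int (e j) *\<^sub>R a j))\<^sup>2)"
    by (simp only: power2_norm_eq_inner inner_diff_left inner_diff_right inner_commute
        sum.distrib[symmetric] sum_subtractf[symmetric] sum_distrib_left)
       (simp add: inner_commute algebra_simps)
  finally have "m * (\<Sum>j<n. (norm (a j))\<^sup>2) \<le> (\<Sum>e\<in>S. (norm (g e))\<^sup>2)"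
    using cross sq by simp
  then show ?thesis
    using m by (simp add: a_def m_def S_def field_simps)
qed

text \<open>The l_q norm is at most the l_2 norm, Bessel's inequality bounds the latter, and
  Jensen's inequality with exponent \<open>q / 2 \<ge> 1\<close> moves the power inside the
  mean.\<close>

lemma rademacher_bessel_powr:
  fixes g :: "(nat \<Rightarrow> int) \<Rightarrow> 'b::real_inner"
  assumes "q \<ge> 2"
  shows "(\<Sum>j<n. norm (rademacher_coeff n g j) powr q) \<le>
    (\<Sum>e\<in>sign_vectors n. norm (g e) powr q) / card (sign_vectors n)"
proof -
  have "(\<Sum>j<n. norm (rademacher_coeff n g j) powr q) \<le>
      (\<Sum>j<n. (norm (rademacher_coeff n g j))\<^sup>2) powr (q / 2)"
    using assms by (intro sum_powr_le_powr_sum_squares) auto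
  also have "\<dots> \<le> ((\<Sum>e\<in>sign_vectors n. (norm (g e))\<^sup>2) / card (sign_vectors n)) powr (q / 2)"
    using assms by (intro powr_mono2 rademacher_bessel sum_nonneg) auto
  also have "\<dots> \<le> (\<Sum>e\<in>sign_vectors n. ((norm (g e))\<^sup>2) powr (q / 2)) / card (sign_vectors n)"
    using assms by (intro powr_mean_le_mean_powr finite_sign_vectors) auto
  also have "(\<Sum>e\<in>sign_vectors n. ((norm (g e))\<^sup>2) powr (q / 2)) =
      (\<Sum>e\<in>sign_vectors n. norm (g e) powr q)"
  proof (rule sum.cong[OF refl])
    fix e
    show "((norm (g e))\<^sup>2) powr (q / 2) = norm (g e) powr q"
      by (cases "g e = 0") (simp_all add: powr_powr powr_numeral[symmetric] del: powr_numeral)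
  qed
  finally show ?thesis .
qed

section \<open>Cotype on the grid\<close>

text \<open>The function E_j F of the overview. The signs run over the whole cube and coordinate
  \<open>j\<close> is erased afterwards; for \<open>j < n\<close> each pattern of the other signs
  occurs twice, which does not affect the mean.\<close>

definition transverse_mean :: "nat \<Rightarrow> ((nat \<Rightarrow> int) \<Rightarrow> 'b::real_vector) \<Rightarrow> nat \<Rightarrow> (nat \<Rightarrow> int) \<Rightarrow> 'b" where
  "transverse_mean n \<phi> j x =
     (1 / card (sign_vectors n)) *\<^sub>R (\<Sum>e\<in>sign_vectors n. \<phi> (\<lambda>i. x i + (e(j := 0)) i))"

text \<open>Pairing \<open>e\<close> with its flip at \<open>j\<close> cancels
  \<open>\<phi> x\<close> and leaves a difference between two opposite faces of the cube; every pair
  is counted twice, hence the factor \<open>1 / 2\<close>.\<close>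

lemma rademacher_coeff_eq_transverse_mean:
  fixes \<phi> :: "(nat \<Rightarrow> int) \<Rightarrow> 'b::real_vector"
  assumes j: "j < n"
  shows "rademacher_coeff n (\<lambda>e. \<phi> (\<lambda>i. x i + e i) - \<phi> x) j =
    (1 / 2) *\<^sub>R (transverse_mean n \<phi> j (x(j := x j + 1)) - transverse_mean n \<phi> j (x(j := x j - 1)))"
proof -
  define S where "S = sign_vectors n"
  define g where "g = (\<lambda>e. real_of_int (e j) *\<^sub>R (\<phi> (\<lambda>i. x i + e i) - \<phi> x))"
  define d where "d = (\<lambda>e :: nat \<Rightarrow> int. \<phi> (\<lambda>i. (x(j := x j + 1)) i + (e(j := 0)) i)
      - \<phi> (\<lambda>i. (x(j := x j - 1)) i + (e(j := 0)) i))"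
  have "2 *\<^sub>R (\<Sum>e\<in>S. g e) = (\<Sum>e\<in>S. g e) + (\<Sum>e\<in>S. g (e(j := - e j)))"
    using sum_sign_vectors_flip[OF j, of g] by (simp add: S_def scaleR_2)
  also have "\<dots> = (\<Sum>e\<in>S. g e + g (e(j := - e j)))"
    by (simp add: sum.distrib)
  also have "\<dots> = (\<Sum>e\<in>S. d e)"
  proof (rule sum.cong[OF refl])
    fix e assume "e \<in> S"
    then consider "e j = 1" | "e j = -1"
      using j by (auto simp: S_def sign_vectors_def)
    then show "g e + g (e(j := - e j)) = d e"
    proof cases
      case 1
      have "(\<lambda>i. (x(j := x j + 1)) i + (e(j := 0)) i) = (\<lambda>i. x i + e i)"
        "(\<lambda>i. (x(j := x j - 1)) i + (e(j := 0)) i) = (\<lambda>i. x i + (e(j := - e j)) i)"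
        using 1 by auto
      then show ?thesis using 1 by (simp add: g_def d_def)
    next
      case 2
      have "(\<lambda>i. (x(j := x j - 1)) i + (e(j := 0)) i) = (\<lambda>i. x i + e i)"
        "(\<lambda>i. (x(j := x j + 1)) i + (e(j := 0)) i) = (\<lambda>i. x i + (e(j := - e j)) i)"
        using 2 by auto
      then show ?thesis using 2 by (simp add: g_def d_def)
    qed
  qed
  finally have eq: "(\<Sum>e\<in>S. g e) = (1 / 2) *\<^sub>R (\<Sum>e\<in>S. d e)"
    by (metis (no_types, lifting) divide_self_if scaleR_one scaleR_scaleR times_divide_eq_left
        mult_1 zero_neq_numeral)
  have "rademacher_coeff n (\<lambda>e. \<phi> (\<lambda>i. x i + e i) - \<phi> x) j = (1 / card S) *\<^sub>R (\<Sum>e\<in>S. g e)"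
    by (simp add: rademacher_coeff_def S_def g_def)
  also have "\<dots> = (1 / 2) *\<^sub>R ((1 / card S) *\<^sub>R (\<Sum>e\<in>S. d e))"
    by (simp add: eq)
  also have "(1 / card S) *\<^sub>R (\<Sum>e\<in>S. d e) =
      transverse_mean n \<phi> j (x(j := x j + 1)) - transverse_mean n \<phi> j (x(j := x j - 1))"
    by (simp only: transverse_mean_def S_def d_def sum_subtractf scaleR_diff_right)
  finally show ?thesis .
qed

text \<open>Steps are measured in the sup distance because the averages move all coordinates at
  once, or all but one. A point is its own neighbour, which later gives
  \<open>W \<ge> 0\<close>.\<close>

definition neighbours :: "nat \<Rightarrow> (nat \<Rightarrow> int) \<Rightarrow> (nat \<Rightarrow> int) \<Rightarrow> bool" where
  "neighbours n x y \<longleftrightarrow> (\<forall>i<n. \<bar>x i - y i\<bar> \<le> 1) \<and> (\<forall>i\<ge>n. x i = y i)"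

lemma neighbours_add_sign_vector:
  assumes "e \<in> sign_vectors n"
  shows "neighbours n (\<lambda>i. x i + e i) x"
proof -
  have "\<bar>e i\<bar> \<le> 1" "i \<ge> n \<Longrightarrow> e i = 0" for i
    using sign_vectors_abs[OF assms, of i] by auto
  then show ?thesis
    by (simp add: neighbours_def)
qed

lemma neighbours_add_sign_vector_upd:
  assumes "e \<in> sign_vectors n"
  shows "neighbours n (\<lambda>i. x i + (e(j := 0)) i) x"
  using neighbours_add_sign_vector[OF assms, of x] by (simp add: neighbours_def)

text \<open>Large enough to contain the base points of the far pairs, whose coordinates below
  \<open>n\<close> are even numbers in \<open>{0..<2 * int L}\<close> except for one equal to -1.
  Its finiteness later permits a truncation common to all pairs.\<close>

definition grid :: "nat \<Rightarrow> nat \<Rightarrow> (nat \<Rightarrow> int) set" where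
  "grid n L = {x. \<forall>i. (i \<in> {..<n} \<longrightarrow> x i \<in> {-1..2 * int L}) \<and> (i \<notin> {..<n} \<longrightarrow> x i = 0)}"

lemma finite_grid: "finite (grid n L)"
  unfolding grid_def by (rule finite_set_of_finite_funs) auto

text \<open>Indices of cubes, at half scale: with centres \<open>2 * x\<close>, consecutive cubes
  along a line share a face, at an odd coordinate.\<close>

definition index_box :: "nat \<Rightarrow> nat \<Rightarrow> (nat \<Rightarrow> int) set" where
  "index_box n L = {x. \<forall>i. (i \<in> {..<n} \<longrightarrow> x i \<in> {0..<int L}) \<and> (i \<notin> {..<n} \<longrightarrow> x i = 0)}"

lemma finite_index_box: "finite (index_box n L)"
  unfolding index_box_def by (rule finite_set_of_finite_funs) auto

text \<open>Exchanging \<open>t\<close> and \<open>x j\<close> is an involution of \<open>index_box n L \<times> {..<L}\<close>.\<close>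

lemma sum_box_lines:
  fixes g :: "(nat \<Rightarrow> int) \<Rightarrow> real"
  assumes "j < n"
  shows "(\<Sum>x\<in>index_box n L. \<Sum>t<L. g (x(j := int t))) = L * (\<Sum>x\<in>index_box n L. g x)"
proof -
  have "(\<Sum>x\<in>index_box n L. \<Sum>t<L. g (x(j := int t))) =
      (\<Sum>(x, t)\<in>index_box n L \<times> {..<L}. g (x(j := int t)))"
    by (simp add: sum.cartesian_product)
  also have "\<dots> = (\<Sum>(x, t)\<in>index_box n L \<times> {..<L}. g x)"
    by (rule sum.reindex_bij_witness[where i = "\<lambda>(x, t). (x(j := int t), nat (x j))"
          and j = "\<lambda>(x, t). (x(j := int t), nat (x j))"])
       (use assms in \<open>auto simp: index_box_def\<close>)
  also have "\<dots> = L * (\<Sum>x\<in>index_box n L. g x)"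
    by (simp add: sum.cartesian_product[symmetric] sum_distrib_left)
  finally show ?thesis .
qed

text \<open>A cotype inequality for maps into a finite l_q sum of inner product spaces. Bessel's
  inequality controls the increments of the transverse means in all directions together, averaging
  singles out one line along which they are small, and the means stay close to the maps
  themselves.\<close>

lemma exists_far_pair_of_neighbour_bound:
  fixes \<phi> :: "'a \<Rightarrow> (nat \<Rightarrow> int) \<Rightarrow> 'b::real_inner"
  assumes A: "finite A" and q: "q \<ge> 2" and L: "L \<ge> 1" "real L powr q \<le> n"
    and step: "\<And>x y. neighbours n x y \<Longrightarrow> (\<Sum>a\<in>A. norm (\<phi> a x - \<phi> a y) powr q) \<le> W"
  shows "\<exists>x\<in>grid n L. \<exists>j<n. (\<Sum>a\<in>A. norm (\<phi> a (x(j := x j + 2 * int L)) - \<phi> a x) powr q)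
    \<le> 3 powr q * (2 powr q + 2) * W"
proof -
  define S where "S = sign_vectors n"
  have S: "finite S" "card S > 0"
    by (auto simp: S_def finite_sign_vectors card_sign_vectors_pos)
  have n: "n > 0"
  proof (rule ccontr)
    assume "\<not> n > 0"
    then have "real L powr q \<le> 0" using L by simp
    then show False using L by simp
  qed
  define h where "h = (\<lambda>j x. \<Sum>a\<in>A.
    norm (rademacher_coeff n (\<lambda>e. \<phi> a (\<lambda>i. x i + e i) - \<phi> a x) j) powr q)"
  define m where "m = (\<lambda>a. transverse_mean n (\<phi> a))"
  \<comment> \<open>Stated for a general displacement \<open>p\<close>: it serves \<open>e\<close>
    itself in \<open>bessel\<close> and \<open>e(j := 0)\<close> in
    \<open>smoothing\<close>.\<close>
  have average: "(\<Sum>a\<in>A. (\<Sum>e\<in>S. norm (\<phi> a (\<lambda>i. x i + p e i) - \<phi> a x) powr q) / card S) \<le> W"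
    if p: "\<And>e. e \<in> S \<Longrightarrow> neighbours n (\<lambda>i. x i + p e i) x"
    for x and p :: "(nat \<Rightarrow> int) \<Rightarrow> nat \<Rightarrow> int"
  proof -
    have "(\<Sum>a\<in>A. (\<Sum>e\<in>S. norm (\<phi> a (\<lambda>i. x i + p e i) - \<phi> a x) powr q) / card S) =
        (\<Sum>e\<in>S. \<Sum>a\<in>A. norm (\<phi> a (\<lambda>i. x i + p e i) - \<phi> a x) powr q) / card S"
      by (subst sum.swap) (simp add: sum_divide_distrib)
    also have "\<dots> \<le> (\<Sum>e\<in>S. W) / card S"
      by (intro divide_right_mono sum_mono step p) auto
    also have "\<dots> = W" using S by auto
    finally show ?thesis .
  qed
  have bessel: "(\<Sum>j<n. h j x) \<le> W" for x
  proof -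
    have "(\<Sum>j<n. h j x) = (\<Sum>a\<in>A. \<Sum>j<n.
        norm (rademacher_coeff n (\<lambda>e. \<phi> a (\<lambda>i. x i + e i) - \<phi> a x) j) powr q)"
      unfolding h_def by (rule sum.swap)
    also have "\<dots> \<le> (\<Sum>a\<in>A. (\<Sum>e\<in>S. norm (\<phi> a (\<lambda>i. x i + e i) - \<phi> a x) powr q) / card S)"
      unfolding S_def by (intro sum_mono rademacher_bessel_powr q)
    also have "\<dots> \<le> W"
      by (rule average) (auto simp: S_def intro: neighbours_add_sign_vector)
    finally show ?thesis .
  qed
  have smoothing: "(\<Sum>a\<in>A. norm (m a j x - \<phi> a x) powr q) \<le> W" for j x
  proof -
    have "norm (m a j x - \<phi> a x) powr q \<le>
        (\<Sum>e\<in>S. norm (\<phi> a (\<lambda>i. x i + (e(j := 0)) i) - \<phi> a x) powr q) / card S" for a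
    proof -
      have "m a j x - \<phi> a x = (1 / card S) *\<^sub>R (\<Sum>e\<in>S. \<phi> a (\<lambda>i. x i + (e(j := 0)) i) - \<phi> a x)"
        using S(2) by (simp add: m_def transverse_mean_def S_def sum_subtractf
            scaleR_diff_right sum_constant_scaleR)
      then show ?thesis
        using norm_mean_powr_le[OF S(1), of q "\<lambda>e. \<phi> a (\<lambda>i. x i + (e(j := 0)) i) - \<phi> a x"] q
        by simp
    qed
    then have "(\<Sum>a\<in>A. norm (m a j x - \<phi> a x) powr q) \<le>
       (\<Sum>a\<in>A. (\<Sum>e\<in>S. norm (\<phi> a (\<lambda>i. x i + (e(j := 0)) i) - \<phi> a x) powr q) / card S)"
      by (rule sum_mono)
    also have "\<dots> \<le> W"
      by (rule average) (simp only: S_def neighbours_add_sign_vector_upd)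
    finally show ?thesis .
  qed
  define B where "B = index_box n L"
  have B: "finite B" "B \<noteq> {}"
    using L(1) finite_index_box by (auto simp: B_def index_box_def intro!: exI[of _ "\<lambda>_. 0"])
  \<comment> \<open>Pigeonhole: if every line in every direction exceeded \<open>L * W / n\<close>,
    the sum over \<open>j\<close> and \<open>B\<close> would, by \<open>sum_box_lines\<close>,
    exceed \<open>L * W * card B\<close>, against \<open>bessel\<close>.\<close>
  have "\<exists>j<n. \<exists>x\<in>B. (\<Sum>t<L. h j (\<lambda>i. 2 * (x(j := int t)) i)) \<le> L * W / n"
  proof (rule ccontr)
    assume "\<not> ?thesis"
    then have "(\<Sum>j<n. \<Sum>x\<in>B. L * W / n) < (\<Sum>j<n. \<Sum>x\<in>B. \<Sum>t<L. h j (\<lambda>i. 2 * (x(j := int t)) i))"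
      using n B by (intro sum_strict_mono) (auto simp: not_le)
    also have "\<dots> = (\<Sum>j<n. L * (\<Sum>x\<in>B. h j (\<lambda>i. 2 * x i)))"
      unfolding B_def by (intro sum.cong refl sum_box_lines) auto
    also have "\<dots> = L * (\<Sum>x\<in>B. \<Sum>j<n. h j (\<lambda>i. 2 * x i))"
      by (subst sum.swap) (simp add: sum_distrib_left)
    also have "\<dots> \<le> L * (\<Sum>x\<in>B. W)"
      by (intro mult_left_mono sum_mono bessel) auto
    finally show False using n by simp
  qed
  then obtain j x where j: "j < n" and x: "x \<in> B"
    and line: "(\<Sum>t<L. h j (\<lambda>i. 2 * (x(j := int t)) i)) \<le> L * W / n"
    by blast
  \<comment> \<open>\<open>y s\<close> is the point at position \<open>s\<close> of the chosen line.
    The centres sit at 0, 2, ..., 2L - 2, so the increments of the means run between the odd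
    positions -1, 1, ..., 2L - 1 and telescope.\<close>
  define y where "y = (\<lambda>s. (\<lambda>i. 2 * x i)(j := s))"
  define u v where "u = y (-1)" and "v = y (2 * int L - 1)"
  have W: "W \<ge> 0"
    using step[of "\<lambda>_. 0" "\<lambda>_. 0"] by (simp add: neighbours_def)
  have far: "(\<Sum>a\<in>A. norm (m a j v - m a j u) powr q) \<le> 2 powr q * W"
  proof -
    \<comment> \<open>The telescoped sum is \<open>2 * L\<close> times the mean of \<open>L\<close>
      Rademacher coefficients, so convexity gives the constant
      \<open>(2 * L) powr q / L\<close>.\<close>
    have "norm (m a j v - m a j u) powr q \<le> (2 * L) powr q / L *
        (\<Sum>t<L. norm (rademacher_coeff n
          (\<lambda>e. \<phi> a (\<lambda>i. 2 * (x(j := int t)) i + e i) - \<phi> a (\<lambda>i. 2 * (x(j := int t)) i)) j) powr q)"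
      (is "_ \<le> _ * (\<Sum>t<L. norm (?r t) powr q)") for a
    proof -
      have r: "2 *\<^sub>R ?r t = m a j (y (2 * int (Suc t) - 1)) - m a j (y (2 * int t - 1))" for t
      proof -
        have z: "2 * (x(j := int t)) i = y (2 * int t) i" for i
          by (auto simp: y_def)
        show ?thesis
          unfolding z rademacher_coeff_eq_transverse_mean[OF j] m_def by (simp add: y_def add.commute)
      qed
      have "m a j v - m a j u = (\<Sum>t<L. 2 *\<^sub>R ?r t)"
        unfolding r u_def v_def
        by (subst sum_lessThan_telescope[of "\<lambda>t. m a j (y (2 * int t - 1))"]) simp
      also have "\<dots> = (2 * real L) *\<^sub>R ((1 / card {..<L}) *\<^sub>R (\<Sum>t<L. ?r t))"
        using L(1) by (simp add: scaleR_sum_right)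
      finally have "norm (m a j v - m a j u) powr q =
          (2 * L) powr q * norm ((1 / card {..<L}) *\<^sub>R (\<Sum>t<L. ?r t)) powr q"
        by (simp only: norm_scaleR[of "2 * real L"] powr_mult abs_ge_zero norm_ge_zero) simp
      also have "\<dots> \<le> (2 * L) powr q * ((\<Sum>t<L. norm (?r t) powr q) / card {..<L})"
        using q by (intro mult_left_mono norm_mean_powr_le) auto
      finally show ?thesis by simp
    qed
    then have "(\<Sum>a\<in>A. norm (m a j v - m a j u) powr q) \<le> (\<Sum>a\<in>A. (2 * L) powr q / L *
        (\<Sum>t<L. norm (rademacher_coeff n
          (\<lambda>e. \<phi> a (\<lambda>i. 2 * (x(j := int t)) i + e i) - \<phi> a (\<lambda>i. 2 * (x(j := int t)) i)) j) powr q))"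
      by (rule sum_mono)
    also have "\<dots> = (2 * L) powr q / L * (\<Sum>t<L. h j (\<lambda>i. 2 * (x(j := int t)) i))"
      unfolding h_def by (subst sum.swap) (simp add: sum_distrib_left)
    also have "\<dots> \<le> (2 * L) powr q / L * (L * W / n)"
      by (intro mult_left_mono line) auto
    also have "\<dots> = 2 powr q * W * (L powr q / n)"
      using L(1) by (simp add: powr_mult)
    \<comment> \<open>Here the side of the box is balanced against the dimension by
      \<open>real L powr q \<le> n\<close>.\<close>
    also have "\<dots> \<le> 2 powr q * W * 1"
      using L n W by (intro mult_left_mono) auto
    finally show ?thesis by simp
  qed
  have "(\<Sum>a\<in>A. norm (\<phi> a v - \<phi> a u) powr q) \<le> (\<Sum>a\<in>A. 3 powr q *
      (norm (m a j v - \<phi> a v) powr q + norm (m a j v - m a j u) powr q + norm (m a j u - \<phi> a u) powr q))"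
  proof (rule sum_mono)
    fix a
    show "norm (\<phi> a v - \<phi> a u) powr q \<le> 3 powr q *
      (norm (m a j v - \<phi> a v) powr q + norm (m a j v - m a j u) powr q + norm (m a j u - \<phi> a u) powr q)"
      using powr_norm_add3_le[of q "\<phi> a v - m a j v" "m a j v - m a j u" "m a j u - \<phi> a u"] q
      by (simp add: norm_minus_commute)
  qed
  also have "\<dots> = 3 powr q * ((\<Sum>a\<in>A. norm (m a j v - \<phi> a v) powr q) +
      (\<Sum>a\<in>A. norm (m a j v - m a j u) powr q) + (\<Sum>a\<in>A. norm (m a j u - \<phi> a u) powr q))"
    by (simp add: sum_distrib_left[symmetric] sum.distrib)
  also have "\<dots> \<le> 3 powr q * (W + 2 powr q * W + W)"
    by (intro mult_left_mono add_mono smoothing far) auto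
  also have "\<dots> = 3 powr q * (2 powr q + 2) * W"
    by (simp add: algebra_simps)
  finally have "(\<Sum>a\<in>A. norm (\<phi> a v - \<phi> a u) powr q) \<le> 3 powr q * (2 powr q + 2) * W" .
  moreover have "v = u(j := u j + 2 * int L)"
    by (simp add: u_def v_def y_def)
  moreover have "u \<in> grid n L"
    using x j by (force simp: u_def y_def B_def index_box_def grid_def)
  ultimately show ?thesis
    using j by blast
qed

section \<open>Embedding the modular into a power of a distance\<close>

lemma orlicz_scale:
  assumes "orlicz_function N" "0 \<le> u" "u \<le> 1" "0 \<le> t"
  shows "N (u * t) \<le> u * N t"
  using orlicz_convex[OF assms(1), of t 0 u "1 - u"] orlicz_zero[OF assms(1)] assms by simp

text \<open>
  The index of \<open>N\<close> only controls \<open>N\<close> near \<open>0\<close>. Replacing \<open>N\<close> by a linear function beyond \<open>1\<close>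
  makes the power estimate hold on the whole half-line and still dominates large differences.
\<close>

definition linear_extension :: "(real \<Rightarrow> real) \<Rightarrow> real \<Rightarrow> real" where
  "linear_extension N r = (if r \<le> 1 then N r else N 1 * r)"

context
  fixes N :: "real \<Rightarrow> real"
  assumes N: "orlicz_function N" "nondegenerate N"
begin

lemma linear_extension_nonneg: "r \<ge> 0 \<Longrightarrow> linear_extension N r \<ge> 0"
  using orlicz_nonneg[OF N(1)] by (simp add: linear_extension_def)

text \<open>Beyond 1 the linear function prolongs the chord of \<open>N\<close> over
  \<open>[0, 1]\<close>, which lies below a convex function there.\<close>

lemma linear_extension_le:
  assumes "r \<ge> 0"
  shows "linear_extension N r \<le> N r"
proof (cases "r \<le> 1")
  case False
  then show ?thesis
    using orlicz_scale[OF N(1), of "1 / r" r] by (simp add: linear_extension_def field_simps)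
qed (simp add: linear_extension_def)

text \<open>In other words, the quotient of the function by \<open>r\<close> is nondecreasing; the
  cut at 1 is harmless because both formulas give \<open>N 1\<close> there.\<close>

lemma linear_extension_scale:
  assumes "0 \<le> u" "u \<le> 1" "0 \<le> r"
  shows "linear_extension N (u * r) \<le> u * linear_extension N r"
proof -
  consider "r \<le> 1" | "r > 1" "u * r \<le> 1" | "r > 1" "u * r > 1"
    by linarith
  then show ?thesis
  proof cases
    case 1
    then have "u * r \<le> 1"
      using assms by (meson dual_order.trans mult_left_le_one_le)
    then show ?thesis
      using 1 assms orlicz_scale[OF N(1)] by (simp add: linear_extension_def)
  next
    case 2
    then show ?thesis
      using assms orlicz_scale[OF N(1), of "u * r" 1] by (simp add: linear_extension_def mult_ac)
  qed (simp add: linear_extension_def)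
qed

lemma linear_extension_mono:
  assumes "0 \<le> s" "s \<le> r"
  shows "linear_extension N s \<le> linear_extension N r"
proof (cases "r = 0")
  case False
  then have "linear_extension N s \<le> (s / r) * linear_extension N r"
    using linear_extension_scale[of "s / r" r] assms by simp
  also have "\<dots> \<le> 1 * linear_extension N r"
    using assms False linear_extension_nonneg by (intro mult_right_mono) (auto simp: field_simps)
  finally show ?thesis by simp
qed (use assms in auto)

text \<open>Up to 1 this is \<open>lower\<close>. If \<open>d \<le> 1 < r\<close>, one compares
  \<open>d\<close> with 1 and uses \<open>r \<le> r powr p\<close>. If \<open>d > 1\<close>, the
  function is linear and \<open>c \<le> 1\<close>, so \<open>(d / r) powr p \<le> d / r\<close>
  suffices. The last two cases rest on \<open>p \<ge> 1\<close>.\<close>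

lemma linear_extension_lower:
  assumes c: "0 < c" and "p \<ge> 1"
    and lower: "\<And>l t. 0 < l \<Longrightarrow> l \<le> 1 \<Longrightarrow> 0 < t \<Longrightarrow> t \<le> 1 \<Longrightarrow> c * t powr p * N l \<le> N (l * t)"
    and d: "0 < d" "d \<le> r"
  shows "c * (d / r) powr p * linear_extension N r \<le> linear_extension N d"
proof -
  have N1: "N 1 > 0"
    using N(2) by (simp add: nondegenerate_def)
  have "c \<le> 1"
    using lower[of 1 1] N1 by simp
  consider "r \<le> 1" | "r > 1" "d \<le> 1" | "d > 1"
    by linarith
  then show ?thesis
  proof cases
    case 1
    then show ?thesis
      using lower[of r "d / r"] d by (simp add: linear_extension_def)
  next
    case 2
    have "c * (d / r) powr p * linear_extension N r = c * d powr p * N 1 * (r / r powr p)"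
      using 2 d by (simp add: linear_extension_def powr_divide)
    also have "\<dots> \<le> c * d powr p * N 1 * 1"
    proof (intro mult_left_mono)
      have "r powr 1 \<le> r powr p"
        using 2 assms(2) by (intro powr_mono) auto
      then show "r / r powr p \<le> 1"
        using 2 by simp
    qed (use c N1 in auto)
    also have "\<dots> \<le> N d"
      using lower[of 1 d] 2 d by simp
    finally show ?thesis
      using 2 by (simp add: linear_extension_def)
  next
    case 3
    have "(d / r) powr p \<le> (d / r) powr 1"
      using d assms(2) by (intro powr_mono') auto
    then have "c * (d / r) powr p \<le> 1 * (d / r)"
      using \<open>c \<le> 1\<close> c d by (intro mult_mono) auto
    then have "c * (d / r) powr p * (N 1 * r) \<le> 1 * (d / r) * (N 1 * r)"
      using N1 d by (intro mult_right_mono) auto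
    then show ?thesis
      using 3 d by (simp add: linear_extension_def mult.commute)
  qed
qed

end

section \<open>Circles at dyadic scales and the modular as a q-th power of a distance\<close>

lemma sum_two_sided_geometric_le:
  fixes z :: real and k :: int
  assumes "finite I" "0 \<le> z" "z < 1"
  shows "(\<Sum>i\<in>I. z ^ nat \<bar>i - k\<bar>) \<le> 2 / (1 - z)"
proof -
  have one: "(\<Sum>i\<in>J. z ^ nat \<bar>i - k\<bar>) \<le> 1 / (1 - z)"
    if J: "finite J" "inj_on (\<lambda>i. nat \<bar>i - k\<bar>) J" for J
  proof -
    have "(\<Sum>i\<in>J. z ^ nat \<bar>i - k\<bar>) = (\<Sum>m\<in>(\<lambda>i. nat \<bar>i - k\<bar>) ` J. z ^ m)"
      by (simp add: sum.reindex[OF J(2)])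
    also have "\<dots> \<le> (\<Sum>m. z ^ m)"
      using assms J by (intro sum_le_suminf summable_geometric) auto
    also have "\<dots> = 1 / (1 - z)"
      using assms by (intro suminf_geometric) auto
    finally show ?thesis .
  qed
  have "(\<Sum>i\<in>I. z ^ nat \<bar>i - k\<bar>) =
      (\<Sum>i\<in>I \<inter> {k..}. z ^ nat \<bar>i - k\<bar>) + (\<Sum>i\<in>I \<inter> {..<k}. z ^ nat \<bar>i - k\<bar>)"
    by (subst sum.union_disjoint[symmetric]) (use assms in \<open>auto intro!: sum.cong\<close>)
  also have "\<dots> \<le> 1 / (1 - z) + 1 / (1 - z)"
    using assms(1) by (intro add_mono one) (auto simp: inj_on_def)
  finally show ?thesis by simp
qed

lemma norm_cis_diff: "norm (cis a - cis b) = 2 * \<bar>sin ((a - b) / 2)\<bar>"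
proof -
  have "cis a - cis b = cis b * (exp (\<i> * of_real (a - b)) - 1)"
    by (simp add: cis_conv_exp exp_add[symmetric] algebra_simps)
  then show ?thesis
    by (simp only: norm_mult norm_cis dist_exp_i_1 mult_1)
qed

lemma norm_cis_diff_le: "norm (cis a - cis b) \<le> \<bar>a - b\<bar>"
  using abs_sin_x_le_abs_x[of "(a - b) / 2"] by (simp add: norm_cis_diff)

lemma norm_cis_diff_le_2: "norm (cis a - cis b) \<le> 2"
  by (simp add: norm_cis_diff)

text \<open>
  The functions \<open>s \<mapsto> G(2\<^sup>i)\<^sup>1\<^sup>/\<^sup>q cis (s / 2\<^sup>i)\<close> embed the line into \<open>\<ell>\<^sub>q\<close> with the \<open>q\<close>-th power of
  the distance comparable to \<open>G \<bar>s - t\<bar>\<close>: small scales are summable because \<open>G(r)/r\<close> increases,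
  large ones because \<open>G(r)/r\<^sup>p\<close> almost decreases for some \<open>p < q\<close>.
\<close>

lemma sum_cis_scales_le:
  fixes G :: "real \<Rightarrow> real"
  assumes G: "\<And>r. r \<ge> 0 \<Longrightarrow> G r \<ge> 0"
    and upper: "\<And>u r. 0 \<le> u \<Longrightarrow> u \<le> 1 \<Longrightarrow> 0 \<le> r \<Longrightarrow> G (u * r) \<le> u * G r"
    and lower: "\<And>d r. 0 < d \<Longrightarrow> d \<le> r \<Longrightarrow> c * (d / r) powr p * G r \<le> G d"
    and "c > 0" "p < q" "1 \<le> q"
  shows "\<exists>C>0. \<forall>I s t. finite I \<longrightarrow>
    (\<Sum>i\<in>I. G (2 powi i) * norm (cis (s / 2 powi i) - cis (t / 2 powi i)) powr q) \<le> C * G \<bar>s - t\<bar>"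
proof -
  \<comment> \<open>Below the scale of the difference the terms decay with exponent 1, above it with
    exponent \<open>q - p\<close>; \<open>\<theta>\<close> serves both sides, and \<open>z\<close>
    is the ratio of the dominating geometric series.\<close>
  define \<theta> where "\<theta> = min 1 (q - p)"
  define z :: real where "z = 2 powr - \<theta>"
  \<comment> \<open>\<open>2 powr q\<close> bounds the chords at small scales; \<open>1 / c\<close>
    comes from \<open>lower\<close> at large scales.\<close>
  define C' where "C' = max (2 powr q) (1 / c)"
  have \<theta>: "0 < \<theta>" "\<theta> \<le> 1" "\<theta> \<le> q - p"
    using assms by (auto simp: \<theta>_def)
  have z: "0 < z" "z < 1"
    using \<theta> powr_less_mono[of "-\<theta>" 0 2] by (auto simp: z_def)
  have C': "C' > 0" "C' \<ge> 2 powr q" "C' \<ge> 1 / c"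
    by (auto simp: C'_def less_max_iff_disj)
  have bound: "(\<Sum>i\<in>I. G (2 powi i) * norm (cis (s / 2 powi i) - cis (t / 2 powi i)) powr q)
      \<le> (C' * (1 / z) * (2 / (1 - z))) * G \<bar>s - t\<bar>" if I: "finite I" for I s t
  proof (cases "s = t")
    case False
    define d where "d = \<bar>s - t\<bar>"
    have d: "d > 0" using False by (simp add: d_def)
    define k where "k = \<lfloor>log 2 d\<rfloor>"
    have k: "2 powi k \<le> d" "d < 2 powi (k + 1)"
    proof -
      have "2 powr k \<le> d" "d < 2 powr (k + 1)"
        using d by (auto simp: k_def le_log_iff[symmetric] log_less_iff[symmetric])
      then show "2 powi k \<le> d" "d < 2 powi (k + 1)"
        by (simp_all add: powr_real_of_int'[symmetric])
    qed
    \<comment> \<open>The factor \<open>1 / z\<close> pays for the dyadic step lost in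
      \<open>d < 2 powi (k + 1)\<close> at the scales above \<open>k\<close>.\<close>
    have summand: "G (2 powi i) * norm (cis (s / 2 powi i) - cis (t / 2 powi i)) powr q
        \<le> C' * (1 / z) * G d * z ^ nat \<bar>i - k\<bar>" for i :: int
    proof -
      define r :: real where "r = 2 powi i"
      have r: "r > 0" by (simp add: r_def)
      have Gd: "G d \<ge> 0" using G d by simp
      have pz: "2 powr (- \<theta> * real_of_int (int m)) = z ^ m" for m
        by (simp add: z_def powr_powr powr_realpow[symmetric])
      have quot: "2 powi a / 2 powi b = (2::real) powr (a - b)" for a b :: int
        by (simp add: powr_real_of_int'[symmetric] powr_diff)
      show ?thesis
      proof (cases "i \<le> k")
        case True
        have rd: "r \<le> d"
          using power_int_increasing[OF True, of "2::real"] k by (simp add: r_def)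
        have "norm (cis (s / r) - cis (t / r)) powr q \<le> 2 powr q"
          using assms norm_cis_diff_le_2 by (intro powr_mono2) auto
        then have cis: "norm (cis (s / r) - cis (t / r)) powr q \<le> C'"
          using C' by simp
        have "r / d \<le> (r / d) powr \<theta>"
          using powr_mono'[of \<theta> 1 "r / d"] rd r d \<theta> by simp
        also have "\<dots> \<le> (2 powr (i - k)) powr \<theta>"
          unfolding quot[symmetric] r_def using k \<theta> d
          by (intro powr_mono2 divide_left_mono) auto
        also have "\<dots> = z ^ nat \<bar>i - k\<bar>"
          using True pz[of "nat \<bar>i - k\<bar>"] by (simp add: powr_powr algebra_simps)
        also have "\<dots> \<le> 1 / z * z ^ nat \<bar>i - k\<bar>"
          using z by (simp add: field_simps)
        finally have "r / d * G d \<le> 1 / z * z ^ nat \<bar>i - k\<bar> * G d"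
          using Gd by (rule mult_right_mono)
        then have "G r \<le> 1 / z * z ^ nat \<bar>i - k\<bar> * G d"
          using upper[of "r / d" d] rd r d by simp
        then have "G r * norm (cis (s / r) - cis (t / r)) powr q \<le> 1 / z * z ^ nat \<bar>i - k\<bar> * G d * C'"
          using cis Gd z C' by (intro mult_mono) auto
        then show ?thesis
          by (simp add: mult_ac r_def)
      next
        case False
        then have "2 powi (k + 1) \<le> (2 powi i :: real)"
          by (intro power_int_increasing) auto
        then have dr: "d \<le> r"
          using k by (simp add: r_def)
        have "norm (cis (s / r) - cis (t / r)) \<le> d / r"
          using norm_cis_diff_le[of "s / r" "t / r"] r
          by (simp add: d_def diff_divide_distrib[symmetric])
        then have cis: "norm (cis (s / r) - cis (t / r)) powr q \<le> (d / r) powr q"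
          using assms by (intro powr_mono2) auto
        have "(d / r) powr (q - p) \<le> (d / r) powr \<theta>"
          using \<theta> d dr r by (intro powr_mono') auto
        also have "\<dots> \<le> (2 powr (k + 1 - i)) powr \<theta>"
        proof -
          have "d / r \<le> 2 powi (k + 1) / 2 powi i"
            unfolding r_def using k by (intro divide_right_mono) auto
          then have "d / r \<le> 2 powr (k + 1 - i)"
            unfolding quot by simp
          then show ?thesis
            using \<theta> d r by (intro powr_mono2) auto
        qed
        also have "\<dots> = 1 / z * z ^ nat \<bar>i - k\<bar>"
        proof -
          have "(2 powr (k + 1 - i)) powr \<theta> = 2 powr \<theta> * 2 powr (- \<theta> * real_of_int (int (nat \<bar>i - k\<bar>)))"
            using False by (simp add: powr_powr powr_add[symmetric] algebra_simps)
          then show ?thesis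
            unfolding pz by (simp add: z_def powr_minus_divide)
        qed
        finally have decay: "(d / r) powr (q - p) \<le> 1 / z * z ^ nat \<bar>i - k\<bar>" .
        have "G r * norm (cis (s / r) - cis (t / r)) powr q \<le> G r * (d / r) powr q"
          using cis G r by (intro mult_left_mono) auto
        \<comment> \<open>Of the exponent \<open>q\<close>, the part \<open>p\<close> is absorbed by
          \<open>lower\<close> and the part \<open>q - p\<close> gives the decay.\<close>
        also have "\<dots> = 1 / c * (c * (d / r) powr p * G r) * (d / r) powr (q - p)"
          using assms by (simp add: powr_add[symmetric])
        also have "\<dots> \<le> C' * G d * (1 / z * z ^ nat \<bar>i - k\<bar>)"
          using C' lower[OF d dr] r z assms G[of r] Gd
          by (intro mult_mono decay) auto
        finally show ?thesis
          by (simp add: mult_ac r_def)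
      qed
    qed
    have "(\<Sum>i\<in>I. G (2 powi i) * norm (cis (s / 2 powi i) - cis (t / 2 powi i)) powr q) \<le>
        (\<Sum>i\<in>I. C' * (1 / z) * G d * z ^ nat \<bar>i - k\<bar>)"
      by (intro sum_mono summand)
    also have "\<dots> = C' * (1 / z) * G d * (\<Sum>i\<in>I. z ^ nat \<bar>i - k\<bar>)"
      by (simp add: sum_distrib_left)
    also have "\<dots> \<le> C' * (1 / z) * G d * (2 / (1 - z))"
      using C' z d G I by (intro mult_left_mono sum_two_sided_geometric_le) auto
    finally show ?thesis
      by (simp add: d_def mult_ac)
  qed (use C' z G[of 0] in simp)
  show ?thesis
    by (rule exI[of _ "C' * (1 / z) * (2 / (1 - z))"]) (use bound C' z in auto)
qed

text \<open>One scale suffices: for the dyadic number \<open>r\<close> with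
  \<open>d \<le> r < 2 * d\<close> the half-angle \<open>d / r / 2\<close> lies between 1/4 and 1/2,
  so the chord has length at least \<open>2 * sin (1 / 4)\<close>, and \<open>G r \<ge> G d\<close>
  by monotonicity.\<close>

lemma exists_cis_scale_ge:
  fixes G :: "real \<Rightarrow> real"
  assumes G: "\<And>r. r \<ge> 0 \<Longrightarrow> G r \<ge> 0"
    and mono: "\<And>s r. 0 \<le> s \<Longrightarrow> s \<le> r \<Longrightarrow> G s \<le> G r"
    and "s \<noteq> t" "q \<ge> 0"
  shows "\<exists>i. (2 * sin (1 / 4)) powr q * G \<bar>s - t\<bar> \<le>
    G (2 powi i) * norm (cis (s / 2 powi i) - cis (t / 2 powi i)) powr q"
proof -
  define d where "d = \<bar>s - t\<bar>"
  have d: "d > 0" using assms by (simp add: d_def)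
  define k where "k = \<lceil>log 2 d\<rceil>"
  have k: "2 powi (k - 1) < d" "d \<le> 2 powi k"
  proof -
    have "2 powr (k - 1) < d" "d \<le> 2 powr k"
      using d by (auto simp: k_def less_log_iff[symmetric] log_le_iff[symmetric]) linarith
    then show "2 powi (k - 1) < d" "d \<le> 2 powi k"
      by (simp_all add: powr_real_of_int'[symmetric])
  qed
  define r :: real where "r = 2 powi k"
  have r: "r > 0" "d \<le> r" "r < 2 * d"
    using k by (auto simp: r_def power_int_diff)
  have "sin (1 / 4) \<le> sin (w / 2)" if "1 / 2 \<le> w" "w \<le> 1" for w :: real
    using that pi_gt3 by (intro sin_monotone_2pi_le) linarith+
  from this[of "d / r"] have "sin (1 / 4) \<le> sin (d / r / 2)"
    using r by (simp add: field_simps)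
  also have "\<dots> \<le> \<bar>sin ((s / r - t / r) / 2)\<bar>"
  proof -
    have eq: "(s / r - t / r) / 2 = (s - t) / r / 2"
      by (simp add: diff_divide_distrib)
    have "s - t = d \<or> s - t = - d"
      by (auto simp: d_def abs_if)
    then show ?thesis
      unfolding eq by (elim disjE) simp_all
  qed
  finally have "2 * sin (1 / 4) \<le> norm (cis (s / r) - cis (t / r))"
    by (simp add: norm_cis_diff)
  moreover have "sin (1 / 4) \<ge> (0::real)"
    using pi_gt3 by (intro sin_ge_zero) auto
  ultimately have "(2 * sin (1 / 4)) powr q * G d \<le> norm (cis (s / r) - cis (t / r)) powr q * G r"
    using assms d r by (intro mult_mono powr_mono2 mono) auto
  then show ?thesis
    unfolding d_def r_def by (intro exI[of _ k]) (simp add: mult.commute)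
qed

section \<open>The upper Matuszewska-Orlicz index\<close>

lemma upper_MO_quotient_nonneg:
  assumes "orlicz_function M" "0 < l" "0 < t"
  shows "M (l * t) / (M l * t powr q) \<ge> 0"
  using assms orlicz_nonneg[OF assms(1)] by simp

lemma upper_MO_index_set_lower_bound:
  fixes M :: "real \<Rightarrow> real"
  assumes M: "orlicz_function M" "nondegenerate M"
    and q: "(INF (l, t) \<in> {0<..1} \<times> {0<..1}. M (l * t) / (M l * t powr q)) > 0"
  shows "\<exists>c>0. \<forall>l t. 0 < l \<longrightarrow> l \<le> 1 \<longrightarrow> 0 < t \<longrightarrow> t \<le> 1 \<longrightarrow> c * t powr q * M l \<le> M (l * t)"
proof -
  define g where "g = (\<lambda>(l, t). M (l * t) / (M l * t powr q))"
  define c where "c = (INF z \<in> {0<..1} \<times> {0<..1}. g z)"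
  have "c > 0"
    using q by (simp add: c_def g_def)
  moreover have "c * t powr q * M l \<le> M (l * t)" if "0 < l" "l \<le> 1" "0 < t" "t \<le> 1" for l t
  proof -
    have "bdd_below (g ` ({0<..1} \<times> {0<..1}))"
      by (rule bdd_belowI2[of _ 0]) (use upper_MO_quotient_nonneg[OF M(1)] in \<open>auto simp: g_def\<close>)
    then have "c \<le> g (l, t)"
      unfolding c_def by (rule cINF_lower) (use that in auto)
    then show ?thesis
      using M(2) that by (simp add: g_def nondegenerate_def field_simps)
  qed
  ultimately show ?thesis by blast
qed

text \<open>A number below the index is outside the set that defines it, so the infimum of the
  quotients is not positive and some quotient is below \<open>\<epsilon>\<close>.\<close>

lemma below_upper_MO_index:
  fixes M :: "real \<Rightarrow> real"
  assumes M: "orlicz_function M" "nondegenerate M"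
    and q: "ereal q < upper_MO_index M" and "\<epsilon> > 0"
  shows "\<exists>l t. 0 < l \<and> l \<le> 1 \<and> 0 < t \<and> t \<le> 1 \<and> M (l * t) < \<epsilon> * M l * t powr q"
proof -
  define g where "g = (\<lambda>(l, t). M (l * t) / (M l * t powr q))"
  have "\<not> (INF z \<in> {0<..1} \<times> {0<..1}. g z) > 0"
  proof
    assume "(INF z \<in> {0<..1} \<times> {0<..1}. g z) > 0"
    then have "upper_MO_index M \<le> ereal q"
      unfolding upper_MO_index_def g_def by (intro Inf_lower) auto
    then show False using q by simp
  qed
  then have "(INF z \<in> {0<..1} \<times> {0<..1}. g z) < \<epsilon>"
    using assms(4) by simp
  moreover have "bdd_below (g ` ({0<..1} \<times> {0<..1}))"
    by (rule bdd_belowI2[of _ 0]) (use upper_MO_quotient_nonneg[OF M(1)] in \<open>auto simp: g_def\<close>)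
  ultimately obtain l t where "0 < l" "l \<le> 1" "0 < t" "t \<le> 1" "g (l, t) < \<epsilon>"
    by (subst (asm) cINF_less_iff) auto
  then show ?thesis
    using M(2) by (intro exI[of _ l] exI[of _ t]) (simp add: g_def nondegenerate_def field_simps)
qed

section \<open>Grids in Orlicz sequence spaces\<close>

lemma h_space_summable: "x \<in> h_space M \<Longrightarrow> \<rho> > 0 \<Longrightarrow> summable (\<lambda>n. M (\<bar>x n\<bar> / \<rho>))"
  by (simp add: h_space_def)

lemma h_space_iff: "x \<in> h_space M \<longleftrightarrow> (\<forall>\<rho>>0. summable (\<lambda>n. M (\<bar>x n\<bar> / \<rho>)))"
  unfolding h_space_def ell_space_def using zero_less_one by blast

lemma h_space_subset_ell_space: "x \<in> h_space M \<Longrightarrow> x \<in> ell_space M"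
  by (simp add: h_space_def)

lemma orlicz_dist_nonneg: "orlicz_function M \<Longrightarrow> orlicz_dist M x y \<ge> 0"
  by (simp add: orlicz_dist_def orlicz_norm_nonneg)

lemma h_space_diff:
  assumes M: "orlicz_function M" and "x \<in> h_space M" "y \<in> h_space M"
  shows "(\<lambda>n. x n - y n) \<in> h_space M"
  unfolding h_space_iff
proof (intro allI impI)
  fix \<rho> :: real assume \<rho>: "\<rho> > 0"
  let ?g = "\<lambda>n. 1 / 2 * M (\<bar>x n\<bar> / (\<rho> / 2)) + 1 / 2 * M (\<bar>y n\<bar> / (\<rho> / 2))"
  have "summable ?g"
    using assms \<rho> by (intro summable_add summable_mult h_space_summable) auto
  then show "summable (\<lambda>n. M (\<bar>x n - y n\<bar> / \<rho>))"
  proof (rule summable_comparison_test'[where N = 0])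
    fix n
    have "M (\<bar>x n - y n\<bar> / \<rho>) \<le> M (1 / 2 * (\<bar>x n\<bar> / (\<rho> / 2)) + 1 / 2 * (\<bar>y n\<bar> / (\<rho> / 2)))"
      using \<rho> by (intro orlicz_mono[OF M]) (auto simp: field_simps)
    also have "\<dots> \<le> ?g n"
      using \<rho> by (intro orlicz_convex[OF M]) auto
    finally show "norm (M (\<bar>x n - y n\<bar> / \<rho>)) \<le> ?g n"
      using \<rho> orlicz_nonneg[OF M] by simp
  qed
qed

lemma orlicz_norm_le:
  assumes "orlicz_function M" "\<rho> \<in> orlicz_norm_set M x"
  shows "orlicz_norm M x \<le> \<rho>"
  using assms cInf_lower[OF assms(2) orlicz_norm_set_bdd[OF assms(1)]]
  by (auto simp: orlicz_norm_def orlicz_norm_set_def ell_space_def)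

text \<open>The norm is an infimum, so strictness yields an element of the set below
  \<open>\<rho>\<close>, and the set is upward closed.\<close>

lemma mem_orlicz_norm_set:
  assumes M: "orlicz_function M" and "x \<in> ell_space M" "orlicz_norm M x < \<rho>"
  shows "\<rho> \<in> orlicz_norm_set M x"
proof -
  have "Inf (orlicz_norm_set M x) < \<rho>"
    using assms by (simp add: orlicz_norm_def)
  then obtain a where "a \<in> orlicz_norm_set M x" "a < \<rho>"
    using cInf_lessD[OF orlicz_norm_set_nonempty[OF M assms(2)]] by blast
  then show ?thesis
    using orlicz_norm_set_mono[OF M] by simp
qed

text \<open>The target side of the argument, with \<open>K\<close> independent of \<open>n\<close>,
  \<open>L\<close>, \<open>F\<close> and \<open>\<omega>\<close>. If all pairs were far apart,
  finitely many coordinates would already show it; on these, circles at finitely many dyadic scales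
  turn the modular into q-th powers of distances, and the cotype inequality gives a
  contradiction.\<close>

lemma h_space_exists_far_pair:
  fixes N :: "real \<Rightarrow> real"
  assumes N: "orlicz_function N" "nondegenerate N" and c: "c > 0"
    and lower: "\<And>l t. 0 < l \<Longrightarrow> l \<le> 1 \<Longrightarrow> 0 < t \<Longrightarrow> t \<le> 1 \<Longrightarrow> c * t powr p * N l \<le> N (l * t)"
    and pq: "p < q" "2 \<le> q"
  shows "\<exists>K>0. \<forall>n L F \<omega>. L \<ge> 1 \<longrightarrow> real L powr q \<le> real n \<longrightarrow> \<omega> > 0 \<longrightarrow>
    (\<forall>x. F x \<in> h_space N) \<longrightarrow> (\<forall>x y. neighbours n x y \<longrightarrow> orlicz_dist N (F x) (F y) \<le> \<omega>) \<longrightarrow>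
    (\<exists>x\<in>grid n L. \<exists>j<n. orlicz_dist N (F (x(j := x j + 2 * int L))) (F x) \<le> K * \<omega>)"
proof -
  \<comment> \<open>\<open>linear_extension N\<close> grows linearly at infinity, so its lower bound needs an exponent at least 1.\<close>
  define p' where "p' = max 1 p"
  have p': "1 \<le> p'" "p' < q"
    using pq by (auto simp: p'_def)
  have lower': "c * t powr p' * N l \<le> N (l * t)" if "0 < l" "l \<le> 1" "0 < t" "t \<le> 1" for l t
  proof -
    have "c * t powr p' * N l \<le> c * t powr p * N l"
      using that c orlicz_nonneg[OF N(1), of l]
      by (intro mult_right_mono mult_left_mono powr_mono') (auto simp: p'_def)
    then show ?thesis
      using lower[OF that] by simp
  qed
  define G where "G = linear_extension N"
  have G: "\<And>r. r \<ge> 0 \<Longrightarrow> G r \<ge> 0"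
    "\<And>u r. 0 \<le> u \<Longrightarrow> u \<le> 1 \<Longrightarrow> 0 \<le> r \<Longrightarrow> G (u * r) \<le> u * G r"
    "\<And>s r. 0 \<le> s \<Longrightarrow> s \<le> r \<Longrightarrow> G s \<le> G r"
    "\<And>d r. 0 < d \<Longrightarrow> d \<le> r \<Longrightarrow> c * (d / r) powr p' * G r \<le> G d"
    unfolding G_def
    using linear_extension_nonneg[OF N] linear_extension_scale[OF N] linear_extension_mono[OF N]
      linear_extension_lower[OF N c p'(1) lower'] by blast+
  obtain C where C: "C > 0" "\<And>I s t. finite I \<Longrightarrow>
      (\<Sum>i\<in>I. G (2 powi i) * norm (cis (s / 2 powi i) - cis (t / 2 powi i)) powr q) \<le> C * G \<bar>s - t\<bar>"
    using sum_cis_scales_le[of G c p' q] G(1,2,4) c p' by auto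
  define \<gamma> :: real where "\<gamma> = (2 * sin (1 / 4)) powr q"
  have \<gamma>: "\<gamma> > 0"
    using sin_gt_zero[of "1 / 4 :: real"] pi_gt3 by (simp add: \<gamma>_def)
  \<comment> \<open>The cotype constant times the upper constant \<open>C\<close> over the lower
    constant \<open>\<gamma>\<close>: it will bound the sum of \<open>G\<close> over the coordinate
    differences of the pair found.\<close>
  define D where "D = 3 powr q * (2 powr q + 2) * C / \<gamma>"
  have D: "D > 0"
    using C \<gamma> by (simp add: D_def add_pos_pos)
  have N1: "N 1 > 0"
    using N(2) by (simp add: nondegenerate_def)
  \<comment> \<open>\<open>K \<ge> D\<close> brings the modular down to at most 1,
    \<open>K \<ge> D / N 1\<close> brings each coordinate difference into \<open>[0, 1]\<close>, and
    \<open>K \<ge> 1\<close> permits scaling by \<open>1 / K\<close>.\<close>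
  define K where "K = max 1 (max D (D / N 1))"
  have K: "K \<ge> 1" "K \<ge> D" "K \<ge> D / N 1"
    by (auto simp: K_def)
  show ?thesis
  proof (intro exI[of _ "2 * K"] conjI allI impI)
    show "2 * K > 0" using K by simp
    fix n L :: nat and F :: "(nat \<Rightarrow> int) \<Rightarrow> nat \<Rightarrow> real" and \<omega> :: real
    assume L: "L \<ge> 1" "real L powr q \<le> real n" and \<omega>: "\<omega> > 0"
      and F: "\<forall>x. F x \<in> h_space N"
      and near: "\<forall>x y. neighbours n x y \<longrightarrow> orlicz_dist N (F x) (F y) \<le> \<omega>"
    define s :: "(nat \<Rightarrow> int) \<Rightarrow> nat \<Rightarrow> nat \<Rightarrow> int" where "s = (\<lambda>x j. x(j := x j + 2 * int L))"
    show "\<exists>x\<in>grid n L. \<exists>j<n. orlicz_dist N (F (x(j := x j + 2 * int L))) (F x) \<le> 2 * K * \<omega>"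
    proof (rule ccontr)
      assume "\<not> ?thesis"
      then have far: "orlicz_dist N (F (s x j)) (F x) > K * (2 * \<omega>)"
        if "x \<in> grid n L" "j < n" for x j
        using that by (force simp: s_def not_le)
      \<comment> \<open>A distance at most \<open>\<omega>\<close> is strictly below
        \<open>2 * \<omega>\<close>, so at this scale neighbours have modular at most 1; hence the
        factor 2 in \<open>2 * K\<close>.\<close>
      define e where "e = (\<lambda>k x. F x k / (2 * \<omega>))"
      have e: "\<bar>F x k - F y k\<bar> / (2 * \<omega>) = \<bar>e k x - e k y\<bar>" for k x y
        using \<omega> by (simp add: e_def diff_divide_distrib[symmetric] abs_divide)
      have Fdiff: "(\<lambda>k. F x k - F y k) \<in> h_space N" for x y
        using F by (intro h_space_diff N(1)) auto
      \<comment> \<open>For each far pair the modular at scale \<open>K * (2 * \<omega>)\<close>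
        exceeds 1, hence so do its late partial sums; since the grid is finite, one
        \<open>k0\<close> serves all pairs.\<close>
      have "\<forall>z\<in>grid n L \<times> {..<n}. \<forall>\<^sub>F k0 in sequentially.
          (\<Sum>k<k0. N (\<bar>e k (s (fst z) (snd z)) - e k (fst z)\<bar> / K)) > 1"
      proof
        fix z assume z: "z \<in> grid n L \<times> {..<n}"
        define x j where "x = fst z" and "j = snd z"
        define f where "f = (\<lambda>k. N (\<bar>F (s x j) k - F x k\<bar> / (K * (2 * \<omega>))))"
        have f: "f = (\<lambda>k. N (\<bar>e k (s x j) - e k x\<bar> / K))"
          by (simp add: f_def e[symmetric] mult.commute)
        have "K * (2 * \<omega>) \<notin> orlicz_norm_set N (\<lambda>k. F (s x j) k - F x k)"
          using orlicz_norm_le[OF N(1)] far[of x j] z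
          by (force simp: x_def j_def orlicz_dist_def)
        moreover have sf: "summable f"
          unfolding f_def by (rule h_space_summable[OF Fdiff]) (use K \<omega> in auto)
        ultimately have "suminf f > 1"
          using K \<omega> by (auto simp: orlicz_norm_set_def f_def not_le)
        with summable_LIMSEQ[OF sf] have "\<forall>\<^sub>F k0 in sequentially. (\<Sum>k<k0. f k) > 1"
          by (rule order_tendstoD)
        then show "\<forall>\<^sub>F k0 in sequentially.
          (\<Sum>k<k0. N (\<bar>e k (s (fst z) (snd z)) - e k (fst z)\<bar> / K)) > 1"
          unfolding f by (simp add: x_def j_def)
      qed
      then have "\<forall>\<^sub>F k0 in sequentially. \<forall>z\<in>grid n L \<times> {..<n}.
          (\<Sum>k<k0. N (\<bar>e k (s (fst z) (snd z)) - e k (fst z)\<bar> / K)) > 1"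
        by (intro eventually_ball_finite) (simp_all add: finite_grid)
      then obtain k0 where "\<forall>z\<in>grid n L \<times> {..<n}.
          (\<Sum>k<k0. N (\<bar>e k (s (fst z) (snd z)) - e k (fst z)\<bar> / K)) > 1"
        by (auto simp: eventually_sequentially)
      then have k0: "(\<Sum>k<k0. N (\<bar>e k (s x j) - e k x\<bar> / K)) > 1" if "x \<in> grid n L" "j < n" for x j
        using that by force
      have "\<forall>a b. \<exists>i. \<gamma> * G \<bar>a - b\<bar> \<le>
          G (2 powi i) * norm (cis (a / 2 powi i) - cis (b / 2 powi i)) powr q"
      proof (intro allI)
        fix a b
        show "\<exists>i. \<gamma> * G \<bar>a - b\<bar> \<le> G (2 powi i) * norm (cis (a / 2 powi i) - cis (b / 2 powi i)) powr q"
        proof (cases "a = b")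
          case True
          then show ?thesis
            by (simp add: G_def linear_extension_def orlicz_zero[OF N(1)])
        next
          case False
          then show ?thesis
            unfolding \<gamma>_def using pq by (intro exists_cis_scale_ge G(1,3)) auto
        qed
      qed
      \<comment> \<open>Only finitely many differences occur, so finitely many scales \<open>I\<close> suffice for the lower bound.\<close>
      then obtain sc where sc: "\<And>a b. \<gamma> * G \<bar>a - b\<bar> \<le>
          G (2 powi sc a b) * norm (cis (a / 2 powi sc a b) - cis (b / 2 powi sc a b)) powr q"
        by metis
      define I where "I = (\<lambda>(k, x, j). sc (e k (s x j)) (e k x)) ` ({..<k0} \<times> grid n L \<times> {..<n})"
      have I: "finite I"
        by (simp add: I_def finite_grid)
      \<comment> \<open>The weight is a q-th root, so that q-th powers of distances carry the weight
        \<open>G (2 powi i)\<close>.\<close>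
      define \<phi> where "\<phi> = (\<lambda>(k, i) x. (G (2 powi i) powr (1 / q)) *\<^sub>R cis (e k x / 2 powi i))"
      have \<phi>: "norm (\<phi> (k, i) x - \<phi> (k, i) y) powr q =
          G (2 powi i) * norm (cis (e k x / 2 powi i) - cis (e k y / 2 powi i)) powr q" for k i x y
        using pq G(1)[of "2 powi i"]
        by (simp add: \<phi>_def scaleR_diff_right[symmetric] powr_mult powr_powr)
      have "\<exists>x\<in>grid n L. \<exists>j<n. (\<Sum>a\<in>{..<k0} \<times> I.
          norm (\<phi> a (x(j := x j + 2 * int L)) - \<phi> a x) powr q) \<le> 3 powr q * (2 powr q + 2) * C"
      proof (rule exists_far_pair_of_neighbour_bound[OF _ pq(2) L])
        fix x y assume "neighbours n x y"
        then have "orlicz_norm N (\<lambda>k. F x k - F y k) < 2 * \<omega>"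
          using near \<omega> by (force simp: orlicz_dist_def)
        then have "2 * \<omega> \<in> orlicz_norm_set N (\<lambda>k. F x k - F y k)"
          by (intro mem_orlicz_norm_set N h_space_subset_ell_space Fdiff)
        then have modular: "summable (\<lambda>k. N \<bar>e k x - e k y\<bar>)" "(\<Sum>k. N \<bar>e k x - e k y\<bar>) \<le> 1"
          by (auto simp: orlicz_norm_set_def e)
        have "(\<Sum>a\<in>{..<k0} \<times> I. norm (\<phi> a x - \<phi> a y) powr q) =
            (\<Sum>k<k0. \<Sum>i\<in>I. norm (\<phi> (k, i) x - \<phi> (k, i) y) powr q)"
          by (simp add: sum.cartesian_product)
        also have "\<dots> \<le> (\<Sum>k<k0. C * G \<bar>e k x - e k y\<bar>)"
          unfolding \<phi> by (intro sum_mono C(2) I)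
        also have "\<dots> \<le> (\<Sum>k<k0. C * N \<bar>e k x - e k y\<bar>)"
          using C(1) unfolding G_def by (intro sum_mono mult_left_mono linear_extension_le N) auto
        also have "\<dots> = C * (\<Sum>k<k0. N \<bar>e k x - e k y\<bar>)"
          by (simp add: sum_distrib_left)
        also have "\<dots> \<le> C * (\<Sum>k. N \<bar>e k x - e k y\<bar>)"
          using C(1) by (intro mult_left_mono sum_le_suminf modular(1)) (auto intro: orlicz_nonneg[OF N(1)])
        also have "\<dots> \<le> C"
          using C(1) modular(2) by simp
        finally show "(\<Sum>a\<in>{..<k0} \<times> I. norm (\<phi> a x - \<phi> a y) powr q) \<le> C" .
      qed (use I in auto)
      then obtain x j where x: "x \<in> grid n L" and j: "j < n"
        and le: "(\<Sum>a\<in>{..<k0} \<times> I. norm (\<phi> a (s x j) - \<phi> a x) powr q) \<le> 3 powr q * (2 powr q + 2) * C"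
        by (auto simp: s_def)
      define d where "d = (\<lambda>k. \<bar>e k (s x j) - e k x\<bar>)"
      have "\<gamma> * (\<Sum>k<k0. G (d k)) = (\<Sum>k<k0. \<gamma> * G (d k))"
        by (simp add: sum_distrib_left)
      also have "\<dots> \<le> (\<Sum>k<k0. \<Sum>i\<in>I. norm (\<phi> (k, i) (s x j) - \<phi> (k, i) x) powr q)"
      proof (rule sum_mono)
        fix k assume k: "k \<in> {..<k0}"
        define i where "i = sc (e k (s x j)) (e k x)"
        have i: "i \<in> I"
          unfolding I_def i_def using k x j by force
        have "\<gamma> * G (d k) \<le> norm (\<phi> (k, i) (s x j) - \<phi> (k, i) x) powr q"
          unfolding \<phi> d_def i_def by (rule sc)
        also have "\<dots> \<le> (\<Sum>i\<in>I. norm (\<phi> (k, i) (s x j) - \<phi> (k, i) x) powr q)"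
          using i I by (intro member_le_sum) auto
        finally show "\<gamma> * G (d k) \<le> (\<Sum>i\<in>I. norm (\<phi> (k, i) (s x j) - \<phi> (k, i) x) powr q)" .
      qed
      also have "\<dots> = (\<Sum>a\<in>{..<k0} \<times> I. norm (\<phi> a (s x j) - \<phi> a x) powr q)"
        by (simp add: sum.cartesian_product)
      also note le
      finally have Gsum: "(\<Sum>k<k0. G (d k)) \<le> D"
        using \<gamma> by (simp add: D_def field_simps)
      \<comment> \<open>Where \<open>d k > 1\<close>, \<open>G\<close> is linear and a single term
        of the sum already gives \<open>N 1 * d k \<le> D\<close>; division by \<open>K\<close> then
        returns to \<open>[0, 1]\<close>, where \<open>N\<close> lies below its chord.\<close>
      have "N (d k / K) \<le> G (d k) / K" if k: "k < k0" for k
      proof (cases "d k \<le> 1")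
        case True
        then show ?thesis
          using orlicz_scale[OF N(1), of "1 / K" "d k"] K by (simp add: G_def linear_extension_def d_def)
      next
        case False
        have "G (d k) \<le> (\<Sum>k<k0. G (d k))"
          using k G(1) by (intro member_le_sum) (auto simp: d_def)
        then have "N 1 * d k \<le> D"
          using Gsum False by (simp add: G_def linear_extension_def)
        then have "d k \<le> D / N 1"
          using N1 by (simp add: field_simps)
        then have "d k / K \<le> 1"
          using K by (simp add: field_simps)
        then show ?thesis
          using orlicz_scale[OF N(1), of "d k / K" 1] K False
          by (simp add: G_def linear_extension_def mult.commute)
      qed
      then have "(\<Sum>k<k0. N (d k / K)) \<le> (\<Sum>k<k0. G (d k) / K)"
        by (intro sum_mono) auto
      also have "\<dots> \<le> D / K"
        using Gsum K by (simp add: sum_divide_distrib[symmetric] divide_right_mono)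
      also have "\<dots> \<le> 1"
        using K D by (simp add: field_simps)
      finally show False
        using k0[OF x j] by (simp add: d_def)
    qed
  qed
qed

text \<open>The source side. Each grid coordinate is repeated on a block of \<open>k\<close>
  entries, with \<open>k\<close> about \<open>1 / M l\<close>. One step has height proportional to
  \<open>l * t\<close>, where \<open>M\<close> is so small that even \<open>n\<close> simultaneous
  steps stay short, while \<open>2 * L\<close> steps in one coordinate lift a block to height
  proportional to \<open>l\<close>.\<close>

lemma h_space_block_lattice:
  fixes M :: "real \<Rightarrow> real"
  assumes M: "orlicz_function M" "nondegenerate M"
    and q: "ereal q < upper_MO_index M" "q \<ge> 0" and ab: "a > 0" "b > 0"
  shows "\<exists>n L \<Psi>. L \<ge> 1 \<and> real L powr q \<le> real n \<and> (\<forall>x. \<Psi> x \<in> h_space M) \<and>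
    (\<forall>x y. neighbours n x y \<longrightarrow> orlicz_dist M (\<Psi> x) (\<Psi> y) \<le> a) \<and>
    (\<forall>x j. j < n \<longrightarrow> b \<le> orlicz_dist M (\<Psi> (x(j := x j + 2 * int L))) (\<Psi> x))"
proof -
  \<comment> \<open>\<open>R\<close> dominates the required ratio of far to near distances and is at
    least 1, so that \<open>R / t \<ge> 1\<close>.\<close>
  define R where "R = max 1 (b / a)"
  define C where "C = 1 + M 1"
  \<comment> \<open>Chosen so that the bound \<open>2 * (2 * R) powr q * \<epsilon> * C\<close> for
    the modular of neighbours equals 1.\<close>
  define \<epsilon> where "\<epsilon> = 1 / (2 * (2 * R) powr q * C)"
  have R: "R \<ge> 1" "b \<le> R * a"
    using ab by (auto simp: R_def max_def field_simps)
  have C: "C > 0"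
    using orlicz_nonneg[OF M(1), of 1] by (simp add: C_def)
  have \<epsilon>: "\<epsilon> > 0"
    using R C by (simp add: \<epsilon>_def)
  obtain l t where lt: "0 < l" "l \<le> 1" "0 < t" "t \<le> 1" and small: "M (l * t) < \<epsilon> * M l * t powr q"
    using below_upper_MO_index[OF M q(1) \<epsilon>] by blast
  have Ml: "M l > 0"
    using M(2) lt by (simp add: nondegenerate_def)
  \<comment> \<open>The \<open>+ 1\<close> makes the block modular \<open>k * M l\<close> strictly
    larger than 1, as the contradiction in \<open>far\<close> requires; it stays at most
    \<open>C\<close>.\<close>
  define k where "k = nat \<lfloor>1 / M l\<rfloor> + 1"
  have k_real: "real k = of_int \<lfloor>1 / M l\<rfloor> + 1"
    using Ml by (simp add: k_def)
  have "real k > 1 / M l" "real k \<le> 1 / M l + 1"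
    unfolding k_real by linarith+
  then have k: "real k * M l > 1" "real k * M l \<le> 1 + M l" "k > 0"
    using Ml by (simp_all add: field_simps k_def)
  have "M l \<le> M 1"
    using orlicz_mono[OF M(1), of l 1] lt by simp
  then have kC: "real k * M l \<le> C"
    using k by (simp add: C_def)
  \<comment> \<open>After \<open>L\<close> steps of height \<open>a * l * t\<close> a coordinate has
    moved by at least \<open>a * l * R \<ge> l * b\<close>; rounding up costs at most a factor
    2.\<close>
  define L where "L = nat \<lceil>R / t\<rceil>"
  have Rt: "R / t \<ge> 1"
    using R lt by (simp add: field_simps)
  have L_real: "real L = of_int \<lceil>R / t\<rceil>"
    using Rt by (simp add: L_def)
  have L: "real L \<ge> R / t" "real L \<le> 2 * (R / t)"
    unfolding L_real using Rt by linarith+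
  then have L1: "L \<ge> 1"
    using Rt by linarith
  define n where "n = nat \<lceil>real L powr q\<rceil>"
  have Lq1: "real L powr q \<ge> 1"
    using L1 q(2) by (intro ge_one_powr_ge_zero) auto
  have n_real: "real n = of_int \<lceil>real L powr q\<rceil>"
    using Lq1 by (simp add: n_def)
  have n: "real n \<ge> real L powr q" "real n \<le> 2 * real L powr q"
    unfolding n_real using Lq1 by linarith+
  define \<Psi> where "\<Psi> = (\<lambda>(x :: nat \<Rightarrow> int) m. if m < n * k then a * l * t * real_of_int (x (m div k)) else 0)"
  have \<Psi>_diff: "\<Psi> x m - \<Psi> y m = (if m < n * k then a * l * t * real_of_int (x (m div k) - y (m div k)) else 0)"
    for x y m
    by (simp add: \<Psi>_def algebra_simps)
  have \<Psi>_h: "\<Psi> x \<in> h_space M" for x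
    unfolding h_space_iff
  proof (intro allI impI)
    fix \<rho> :: real
    show "summable (\<lambda>m. M (\<bar>\<Psi> x m\<bar> / \<rho>))"
      by (rule summable_finite[of "{..<n * k}"]) (auto simp: \<Psi>_def orlicz_zero[OF M(1)])
  qed
  have near: "orlicz_dist M (\<Psi> x) (\<Psi> y) \<le> a" if xy: "neighbours n x y" for x y
  proof -
    let ?f = "\<lambda>m. M (\<bar>\<Psi> x m - \<Psi> y m\<bar> / a)"
    have zero: "?f m = 0" if "m \<notin> {..<n * k}" for m
      using that by (simp add: \<Psi>_def orlicz_zero[OF M(1)])
    have bound: "?f m \<le> M (l * t)" if m: "m \<in> {..<n * k}" for m
    proof (rule orlicz_mono[OF M(1)])
      have "m div k < n"
        using m by (simp add: less_mult_imp_div_less)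
      then have "\<bar>x (m div k) - y (m div k)\<bar> \<le> 1"
        using xy by (simp add: neighbours_def)
      then have "\<bar>real_of_int (x (m div k) - y (m div k))\<bar> \<le> 1"
        by linarith
      then have "l * t * \<bar>real_of_int (x (m div k) - y (m div k))\<bar> \<le> l * t * 1"
        using lt by (intro mult_left_mono) auto
      then show "\<bar>\<Psi> x m - \<Psi> y m\<bar> / a \<le> l * t"
        unfolding \<Psi>_diff using m lt ab by (simp add: abs_mult)
    qed (use ab in simp)
    have "(\<Sum>m. ?f m) = (\<Sum>m<n * k. ?f m)"
      by (rule suminf_finite) (use zero in auto)
    also have "\<dots> \<le> (\<Sum>m<n * k. M (l * t))"
      by (rule sum_mono) (use bound in auto)
    also have "\<dots> = real n * (real k * M (l * t))"
      by simp
    \<comment> \<open>The growth of \<open>n\<close> like \<open>t powr (- q)\<close> is cancelled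
      by the factor \<open>t powr q\<close> of \<open>small\<close>, and \<open>k * M l\<close>
      stays bounded.\<close>
    also have "\<dots> \<le> (2 * (2 * (R / t)) powr q) * (real k * (\<epsilon> * M l * t powr q))"
    proof (intro mult_mono)
      have "real L powr q \<le> (2 * (R / t)) powr q"
        using L q(2) by (intro powr_mono2) auto
      then show "real n \<le> 2 * (2 * (R / t)) powr q"
        using n by linarith
    qed (use small orlicz_nonneg[OF M(1), of "l * t"] lt in auto)
    also have "\<dots> = 2 * (2 * R) powr q * \<epsilon> * (real k * M l)"
      using lt R by (simp add: powr_mult powr_divide)
    also have "\<dots> \<le> 2 * (2 * R) powr q * \<epsilon> * C"
      using kC \<epsilon> by (intro mult_left_mono) auto
    also have "\<dots> = 1"
      using R C by (simp add: \<epsilon>_def)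
    finally have "(\<Sum>m. ?f m) \<le> 1" .
    moreover have "summable ?f"
      by (rule summable_finite[of "{..<n * k}"]) (use zero in auto)
    ultimately have "a \<in> orlicz_norm_set M (\<lambda>m. \<Psi> x m - \<Psi> y m)"
      using ab by (simp add: orlicz_norm_set_def)
    then show ?thesis
      unfolding orlicz_dist_def by (rule orlicz_norm_le[OF M(1)])
  qed
  have far: "b \<le> orlicz_dist M (\<Psi> (x(j := x j + 2 * int L))) (\<Psi> x)" if j: "j < n" for x j
  proof (rule ccontr)
    let ?y = "x(j := x j + 2 * int L)"
    let ?f = "\<lambda>m. M (\<bar>\<Psi> ?y m - \<Psi> x m\<bar> / b)"
    assume "\<not> ?thesis"
    then have "orlicz_norm M (\<lambda>m. \<Psi> ?y m - \<Psi> x m) < b"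
      by (simp add: orlicz_dist_def)
    then have "b \<in> orlicz_norm_set M (\<lambda>m. \<Psi> ?y m - \<Psi> x m)"
      by (intro mem_orlicz_norm_set M h_space_subset_ell_space h_space_diff \<Psi>_h)
    then have f: "summable ?f" "(\<Sum>m. ?f m) \<le> 1"
      by (auto simp: orlicz_norm_set_def)
    \<comment> \<open>Every entry of the \<open>j\<close>-th block moves by at least
      \<open>l * b\<close>, so this block alone has modular at least \<open>k * M l > 1\<close> at
      scale \<open>b\<close>.\<close>
    have ge: "M l \<le> ?f m" if m: "m \<in> {j * k..<j * k + k}" for m
    proof (rule orlicz_mono[OF M(1)])
      have mj: "m div k = j"
        using m k(3) by (intro div_nat_eqI) (auto simp: mult.commute)
      have "j * k + k \<le> n * k"
        using j mult_le_mono1[of "Suc j" n k] by (simp add: add.commute)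
      then have mn: "m < n * k"
        using m by auto
      have "R \<le> t * real L"
        using L(1) lt by (simp add: field_simps)
      then have "a * l * R \<le> a * l * (t * real L)"
        using ab lt by (intro mult_left_mono) auto
      moreover have "l * b \<le> l * (R * a)"
        using R lt by (intro mult_left_mono) auto
      moreover have "0 \<le> a * l * (t * real L)"
        using ab lt by simp
      ultimately have "l * b \<le> a * l * t * (2 * real L)"
        by (simp add: mult_ac)
      then have "l \<le> a * l * t * (2 * real L) / b"
        using ab by (simp add: field_simps)
      then show "l \<le> \<bar>\<Psi> ?y m - \<Psi> x m\<bar> / b"
        unfolding \<Psi>_diff using mn mj ab lt by (simp add: abs_mult)
    qed (use lt in simp)
    have "real k * M l = (\<Sum>m\<in>{j * k..<j * k + k}. M l)"
      by simp
    also have "\<dots> \<le> (\<Sum>m\<in>{j * k..<j * k + k}. ?f m)"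
      by (intro sum_mono ge)
    also have "\<dots> \<le> (\<Sum>m. ?f m)"
      using f ab orlicz_nonneg[OF M(1)] by (intro sum_le_suminf) auto
    finally show False
      using f k by simp
  qed
  show ?thesis
    using L1 n(1) \<Psi>_h near far by blast
qed

section \<open>The common obstruction to coarse and uniform embeddings\<close>

theorem theorem4p4:
  fixes M N :: "real \<Rightarrow> real"
  assumes "orlicz_function M" and "nondegenerate M"
    and "orlicz_function N" and "nondegenerate N"
    and "upper_MO_index M > 2" and "upper_MO_index N < upper_MO_index M"
  shows "\<not> coarsely_embeds (h_metric M) (h_metric N) \<and>
         \<not> uniformly_embeds (h_metric M) (h_metric N)"
proof -
  note M = assms(1,2) and N = assms(3,4)
  note h_simps = mspace_h_metric[OF M(1)] mspace_h_metric[OF N(1)]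
    mdist_h_metric[OF M(1)] mdist_h_metric[OF N(1)]
  obtain p where p: "(INF (l, t) \<in> {0<..1} \<times> {0<..1}. N (l * t) / (N l * t powr p)) > 0"
    "ereal p < upper_MO_index M"
    using assms(6) unfolding upper_MO_index_def[of N] by (auto simp: Inf_less_iff)
  obtain c where c: "c > 0" and lower: "\<And>l t. 0 < l \<Longrightarrow> l \<le> 1 \<Longrightarrow> 0 < t \<Longrightarrow> t \<le> 1 \<Longrightarrow>
      c * t powr p * N l \<le> N (l * t)"
    using upper_MO_index_set_lower_bound[OF N p(1)] by blast
  \<comment> \<open>An exponent \<open>q\<close> above \<open>p\<close> and 2 but below the index of
    \<open>M\<close> serves both sides: the cotype bound in \<open>h_space N\<close> and the block
    lattice in \<open>h_space M\<close>.\<close>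
  have "ereal (max 2 p) < upper_MO_index M"
    using p(2) assms(5) by (auto simp: max_def)
  then obtain q where q: "ereal (max 2 p) < ereal q" "ereal q < upper_MO_index M"
    using ereal_dense2 by blast
  then have pq: "p < q" "2 \<le> q"
    by auto
  obtain K where K: "K > 0" and target: "\<And>n L F \<omega>. L \<ge> 1 \<Longrightarrow> real L powr q \<le> real n \<Longrightarrow> \<omega> > 0 \<Longrightarrow>
      (\<And>x. F x \<in> h_space N) \<Longrightarrow> (\<And>x y. neighbours n x y \<Longrightarrow> orlicz_dist N (F x) (F y) \<le> \<omega>) \<Longrightarrow>
      \<exists>x\<in>grid n L. \<exists>j<n. orlicz_dist N (F (x(j := x j + 2 * int L))) (F x) \<le> K * \<omega>"
    using h_space_exists_far_pair[OF N c lower pq] by blast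
  \<comment> \<open>\<open>K\<close> does not depend on \<open>f\<close>, \<open>a\<close>,
    \<open>b\<close> or \<open>\<omega>\<close>. Coarse embeddings are refuted by a large
    \<open>b\<close> with \<open>a\<close> fixed, uniform ones by a small \<open>a\<close> with
    \<open>b\<close> fixed.\<close>
  have rigid: "\<exists>x\<in>h_space M. \<exists>y\<in>h_space M. b \<le> orlicz_dist M x y \<and> orlicz_dist N (f x) (f y) \<le> K * \<omega>"
    if f: "f \<in> h_space M \<rightarrow> h_space N" and pos: "a > 0" "b > 0" "\<omega> > 0"
      and mod: "\<And>x y. x \<in> h_space M \<Longrightarrow> y \<in> h_space M \<Longrightarrow> orlicz_dist M x y \<le> a \<Longrightarrow>
        orlicz_dist N (f x) (f y) \<le> \<omega>" for f a b \<omega>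
  proof -
    obtain n L \<Psi> where \<Psi>: "L \<ge> 1" "real L powr q \<le> real n" "\<And>x. \<Psi> x \<in> h_space M"
      "\<And>x y. neighbours n x y \<Longrightarrow> orlicz_dist M (\<Psi> x) (\<Psi> y) \<le> a"
      "\<And>x j. j < n \<Longrightarrow> b \<le> orlicz_dist M (\<Psi> (x(j := x j + 2 * int L))) (\<Psi> x)"
      using h_space_block_lattice[OF M q(2) _ pos(1,2)] pq by force
    have "\<exists>x\<in>grid n L. \<exists>j<n. orlicz_dist N (f (\<Psi> (x(j := x j + 2 * int L)))) (f (\<Psi> x)) \<le> K * \<omega>"
      using f \<Psi>(3,4) by (intro target[OF \<Psi>(1,2) pos(3)] mod) auto
    then show ?thesis
      using \<Psi>(3,5) by blast
  qed
  have "\<not> coarsely_embeds (h_metric M) (h_metric N)"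
  proof
    assume "coarsely_embeds (h_metric M) (h_metric N)"
    then obtain f \<rho>1 \<rho>2 where f: "f \<in> h_space M \<rightarrow> h_space N"
      and \<rho>: "\<rho>2 \<in> {0..} \<rightarrow> {0..}" "mono_on {0..} \<rho>1" "mono_on {0..} \<rho>2" "filterlim \<rho>1 at_top at_top"
      and ineq: "\<And>x y. x \<in> h_space M \<Longrightarrow> y \<in> h_space M \<Longrightarrow>
        \<rho>1 (orlicz_dist M x y) \<le> orlicz_dist N (f x) (f y) \<and>
        orlicz_dist N (f x) (f y) \<le> \<rho>2 (orlicz_dist M x y)"
      unfolding coarsely_embeds_def coarse_embedding_def h_simps by blast
    \<comment> \<open>\<open>\<rho>2 1\<close> may vanish, while \<open>rigid\<close> requires a
      positive bound.\<close>
    define \<omega> where "\<omega> = \<rho>2 1 + 1"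
    have \<omega>: "\<omega> > 0"
      using \<rho>(1) by (force simp: \<omega>_def Pi_iff intro: add_nonneg_pos)
    have "\<forall>\<^sub>F r in at_top. \<rho>1 r > K * \<omega>"
      using \<rho>(4) by (simp add: filterlim_at_top_dense)
    then have "\<forall>\<^sub>F r in at_top. \<rho>1 r > K * \<omega> \<and> r > 0"
      using eventually_gt_at_top[of 0] by (rule eventually_conj)
    then obtain b where b: "b > 0" "\<rho>1 b > K * \<omega>"
      by (auto dest: eventually_happens)
    have "\<exists>x\<in>h_space M. \<exists>y\<in>h_space M. b \<le> orlicz_dist M x y \<and> orlicz_dist N (f x) (f y) \<le> K * \<omega>"
    proof (rule rigid[OF f _ b(1) \<omega>, of 1])
      fix x y assume "x \<in> h_space M" "y \<in> h_space M" "orlicz_dist M x y \<le> 1"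
      then show "orlicz_dist N (f x) (f y) \<le> \<omega>"
        using ineq[of x y] mono_onD[OF \<rho>(3), of "orlicz_dist M x y" 1] orlicz_dist_nonneg[OF M(1), of x y]
        by (simp add: \<omega>_def)
    qed simp
    then obtain x y where xy: "x \<in> h_space M" "y \<in> h_space M" "b \<le> orlicz_dist M x y"
      "orlicz_dist N (f x) (f y) \<le> K * \<omega>"
      by blast
    then have "\<rho>1 b \<le> \<rho>1 (orlicz_dist M x y)"
      using b by (intro mono_onD[OF \<rho>(2)]) auto
    then show False
      using ineq[OF xy(1,2)] xy(4) b by linarith
  qed
  moreover have "\<not> uniformly_embeds (h_metric M) (h_metric N)"
  proof
    assume "uniformly_embeds (h_metric M) (h_metric N)"
    then obtain f where inj: "inj_on f (h_space M)"
      and f: "uniformly_continuous_map (h_metric M) (h_metric N) f"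
      and inv: "uniformly_continuous_map (submetric (h_metric N) (f ` h_space M)) (h_metric M)
        (inv_into (h_space M) f)"
      unfolding uniformly_embeds_def uniform_embedding_def h_simps by blast
    have fh: "f \<in> h_space M \<rightarrow> h_space N"
      using f by (simp add: uniformly_continuous_map_def h_simps)
    obtain \<delta> where \<delta>: "\<delta> > 0" and far: "\<And>x y. x \<in> h_space M \<Longrightarrow> y \<in> h_space M \<Longrightarrow>
        orlicz_dist N (f x) (f y) < \<delta> \<Longrightarrow> orlicz_dist M x y < 1"
    proof -
      have "\<forall>\<epsilon>>0. \<exists>\<delta>>0. \<forall>u\<in>f ` h_space M \<inter> h_space N. \<forall>v\<in>f ` h_space M \<inter> h_space N.
          orlicz_dist N v u < \<delta> \<longrightarrow>
          orlicz_dist M (inv_into (h_space M) f v) (inv_into (h_space M) f u) < \<epsilon>"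
        using inv unfolding uniformly_continuous_map_def mspace_submetric mdist_submetric h_simps
        by (rule conjunct2)
      from this[rule_format, OF zero_less_one]
      obtain \<delta> where "\<delta> > 0" and *: "\<forall>u\<in>f ` h_space M \<inter> h_space N. \<forall>v\<in>f ` h_space M \<inter> h_space N.
          orlicz_dist N v u < \<delta> \<longrightarrow> orlicz_dist M (inv_into (h_space M) f v) (inv_into (h_space M) f u) < 1"
        by blast
      moreover have "orlicz_dist M x y < 1"
        if "x \<in> h_space M" "y \<in> h_space M" "orlicz_dist N (f x) (f y) < \<delta>" for x y
        using *[rule_format, of "f y" "f x"] that fh inv_into_f_f[OF inj] by auto
      ultimately show thesis
        using that by blast
    qed
    \<comment> \<open>With this choice \<open>K * \<omega> = \<delta> / 2\<close>, so the images of
      the pair from \<open>rigid\<close> are closer than \<open>\<delta>\<close> although the points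
      are at distance at least 1.\<close>
    define \<omega> where "\<omega> = \<delta> / (2 * K)"
    have \<omega>: "\<omega> > 0"
      using \<delta> K by (simp add: \<omega>_def)
    obtain \<eta> where \<eta>: "\<eta> > 0" "\<And>x y. x \<in> h_space M \<Longrightarrow> y \<in> h_space M \<Longrightarrow>
        orlicz_dist M x y < \<eta> \<Longrightarrow> orlicz_dist N (f x) (f y) < \<omega>"
      using f \<omega> unfolding uniformly_continuous_map_def h_simps by metis
    \<comment> \<open>Halving \<open>\<eta>\<close> turns the strict bound of uniform continuity
      into the non-strict one of \<open>rigid\<close>.\<close>
    have "\<exists>x\<in>h_space M. \<exists>y\<in>h_space M. 1 \<le> orlicz_dist M x y \<and> orlicz_dist N (f x) (f y) \<le> K * \<omega>"
      using \<eta> by (intro rigid[OF fh, of "\<eta> / 2"] \<omega>) (auto intro!: less_imp_le)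
    then obtain x y where xy: "x \<in> h_space M" "y \<in> h_space M" "1 \<le> orlicz_dist M x y"
      "orlicz_dist N (f x) (f y) \<le> K * \<omega>"
      by blast
    moreover have "K * \<omega> < \<delta>"
      using K \<delta> by (simp add: \<omega>_def)
    ultimately show False
      using far[of x y] by linarith
  qed
  ultimately show ?thesis ..
qed

end
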